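(* Let $H$ be a Hilbert space and $T$ a densely defined closed operator on $H$ with closed range. Then $|T|T^{*}=T|T|$ if and only if $|w(T)|\,w(T)^{*}=w(T)\,|w(T)|$.
   Context: For an operator $A$, $|A|=(A^{*}A)^{1/2}$. For a densely defined closed operator $A$ with closed range, $C(A)=D(A)\cap N(A)^{\perp}$, and the Moore–Penrose inverse $A^{\dagger}$ is defined on $R(A)\oplus^{\perp}R(A)^{\perp}$ by $A^{\dagger}y=(A|_{C(A)})^{-1}y$ for $y\in R(A)$ and $A^{\dagger}y=0$ for $y\in R(A)^{\perp}$. The generalized Cauchy dual is $w(A)=A(A^{*}A)^{\dagger}$; products of unbounded operators are taken on natural domains. *)

theory Defs
  imports "HOL-Analysis.Analysis"
begin

class chilbert = banach +
  fixes scaleC :: "complex \<Rightarrow> 'a \<Rightarrow> 'a"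
    and cinner :: "'a \<Rightarrow> 'a \<Rightarrow> complex"
  assumes scaleC_add_right: "scaleC a (x + y) = scaleC a x + scaleC a y"
    and scaleC_add_left: "scaleC (a + b) x = scaleC a x + scaleC b x"
    and scaleC_scaleC: "scaleC a (scaleC b x) = scaleC (a * b) x"
    and scaleC_one: "scaleC 1 x = x"
    and scaleC_of_real: "scaleC (complex_of_real r) x = scaleR r x"
    and cinner_commute: "cinner x y = cnj (cinner y x)"
    and cinner_add_left: "cinner (x + y) z = cinner x z + cinner y z"
    and cinner_scaleC_left: "cinner (scaleC a x) y = cnj a * cinner x y"
    and cinner_self: "cinner x x = complex_of_real ((norm x)\<^sup>2)"

text \<open>An operator on H is identified with its graph, a subset of H \<times> H.
(x, y) in A means x is in D(A) and A x = y.\<close>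

type_synonym 'a linop = "('a \<times> 'a) set"

definition is_linop :: "'a::chilbert linop \<Rightarrow> bool" where
  "is_linop A \<longleftrightarrow> (0, 0) \<in> A
     \<and> (\<forall>x y u v. (x, y) \<in> A \<longrightarrow> (u, v) \<in> A \<longrightarrow> (x + u, y + v) \<in> A)
     \<and> (\<forall>c x y. (x, y) \<in> A \<longrightarrow> (scaleC c x, scaleC c y) \<in> A)
     \<and> (\<forall>y. (0, y) \<in> A \<longrightarrow> y = 0)"

definition dom_op :: "'a linop \<Rightarrow> 'a set" where
  "dom_op A = fst ` A"

definition ran_op :: "'a linop \<Rightarrow> 'a set" where
  "ran_op A = snd ` A"

definition ker_op :: "'a::zero linop \<Rightarrow> 'a set" where
  "ker_op A = {x. (x, 0) \<in> A}"

definition densely_defined :: "'a::chilbert linop \<Rightarrow> bool" where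
  "densely_defined A \<longleftrightarrow> closure (dom_op A) = UNIV"

definition closed_op :: "'a::chilbert linop \<Rightarrow> bool" where
  "closed_op A \<longleftrightarrow> closed A"

definition orth :: "'a::chilbert set \<Rightarrow> 'a set" where
  "orth S = {y. \<forall>x\<in>S. cinner x y = 0}"

definition adj :: "'a::chilbert linop \<Rightarrow> 'a linop" where
  "adj A = {(y, z). \<forall>x w. (x, w) \<in> A \<longrightarrow> cinner w y = cinner x z}"

definition op_mult :: "'a linop \<Rightarrow> 'a linop \<Rightarrow> 'a linop" (infixl "\<cdot>\<^sub>o" 70) where
  "A \<cdot>\<^sub>o B = {(x, z). \<exists>y. (x, y) \<in> B \<and> (y, z) \<in> A}"

definition positive_selfadjoint :: "'a::chilbert linop \<Rightarrow> bool" where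
  "positive_selfadjoint S \<longleftrightarrow> is_linop S \<and> densely_defined S \<and> adj S = S
     \<and> (\<forall>x y. (x, y) \<in> S \<longrightarrow> 0 \<le> Re (cinner x y))"

definition op_abs :: "'a::chilbert linop \<Rightarrow> 'a linop" where
  "op_abs A = (THE S. positive_selfadjoint S \<and> S \<cdot>\<^sub>o S = adj A \<cdot>\<^sub>o A)"

text \<open>Moore--Penrose inverse, defined on R(A) + R(A)^perp by
  A^dagger (y1 + y2) = (A restricted to C(A))^(-1) y1, y1 in R(A), y2 in R(A)^perp,
  where C(A) = D(A) \<inter> N(A)^perp.\<close>
definition moore_penrose :: "'a::chilbert linop \<Rightarrow> 'a linop" where
  "moore_penrose A = {(y1 + y2, x) | x y1 y2.
      (x, y1) \<in> A \<and> x \<in> orth (ker_op A) \<and> y2 \<in> orth (ran_op A)}"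

definition cauchy_dual :: "'a::chilbert linop \<Rightarrow> 'a linop" where
  "cauchy_dual A = A \<cdot>\<^sub>o moore_penrose (adj A \<cdot>\<^sub>o A)"

end

theory Submission
  imports Defs
begin

text \<open>
  Since the range of \<open>T\<close> is closed, \<open>K = T\<^sup>\<dagger>\<close> is an everywhere defined bounded operator (Baire);
  let \<open>W = K\<^sup>*\<close> and let \<open>R\<close> be the bounded positive square root of \<open>K W\<close>. The operation
  \<open>\<dagger>\<close> is an involution that commutes with adjoints and reverses products of operators with
  matching kernels and ranges, so \<open>T = K\<^sup>\<dagger>\<close>, \<open>T\<^sup>* = W\<^sup>\<dagger>\<close>, \<open>T\<^sup>* T = (K W)\<^sup>\<dagger>\<close> and \<open>|T| = R\<^sup>\<dagger>\<close>, while
  \<open>w(T) = W\<close>, \<open>w(T)\<^sup>* = K\<close> and \<open>|w(T)| = R\<close>. Hence \<open>|T| T\<^sup>* = (W R)\<^sup>\<dagger>\<close> and \<open>T |T| = (R K)\<^sup>\<dagger>\<close>,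
  and both conditions of the theorem say \<open>W R = R K\<close>.
\<close>

subsection \<open>Hilbert space geometry\<close>

text \<open>\<open>op_abs\<close> is a definite description ranging over all positive self-adjoint
  operators, unbounded ones included, so each absolute value costs both existence and uniqueness of
  a square root. The Moore-Penrose inverse makes this a bounded problem: if P is positive
  self-adjoint and its square is the inverse of K W, then the range of P is the orthogonal
  complement of its kernel, hence closed, so P is itself the inverse of an everywhere defined
  positive Q with Q Q = K W. Equality of operators is equality of graphs, domains included. Since
  inversion is injective on everywhere defined operators with an adjoint, equality of two unbounded
  products turns into equality of two functions. When T is unbounded the range of K is not closed,
  so inverses of bounded operators must be handled for arbitrary ranges. Inverses of products
  reverse only under a kernel condition; here it comes from norm (W x) = norm (R x), which gives W
  and R the same kernel, the orthogonal complement of the range of K.\<close>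

lemma cinner_zero_left [simp]: "cinner 0 (x::'a::chilbert) = 0"
  using cinner_add_left[of 0 0 x] by simp

lemma cinner_zero_right [simp]: "cinner (x::'a::chilbert) 0 = 0"
  using cinner_commute[of x 0] by simp

lemma cinner_add_right: "cinner (x::'a::chilbert) (y + z) = cinner x y + cinner x z"
  by (metis cinner_add_left cinner_commute complex_cnj_add)

lemma cinner_scaleC_right: "cinner (x::'a::chilbert) (scaleC a y) = a * cinner x y"
  by (metis cinner_commute cinner_scaleC_left complex_cnj_cnj complex_cnj_mult)

lemma cinner_scaleR_left: "cinner (r *\<^sub>R x) (y::'a::chilbert) = of_real r * cinner x y"
  by (metis cinner_scaleC_left complex_cnj_complex_of_real scaleC_of_real)

lemma cinner_scaleR_right: "cinner x (r *\<^sub>R (y::'a::chilbert)) = of_real r * cinner x y"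
  by (metis cinner_scaleC_right scaleC_of_real)

lemma cinner_minus_left: "cinner (- x) (y::'a::chilbert) = - cinner x y"
  using cinner_scaleR_left[of "-1" x y] by simp

lemma cinner_minus_right: "cinner x (- (y::'a::chilbert)) = - cinner x y"
  using cinner_scaleR_right[of x "-1" y] by simp

lemma cinner_diff_left: "cinner (x - y) (z::'a::chilbert) = cinner x z - cinner y z"
  using cinner_add_left[of x "- y" z] by (simp add: cinner_minus_left)

lemma cinner_diff_right: "cinner x (y - (z::'a::chilbert)) = cinner x y - cinner x z"
  using cinner_add_right[of x y "- z"] by (simp add: cinner_minus_right)

lemmas cinner_simps = cinner_add_left cinner_add_right cinner_diff_left cinner_diff_right
  cinner_minus_left cinner_minus_right cinner_scaleR_left cinner_scaleR_right
  cinner_scaleC_left cinner_scaleC_right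

lemma cinner_eq_zero_commute: "cinner x y = 0 \<longleftrightarrow> cinner y (x::'a::chilbert) = 0"
  by (metis cinner_commute complex_cnj_zero_iff)

lemma Re_cinner_commute: "Re (cinner x y) = Re (cinner y (x::'a::chilbert))"
  by (subst cinner_commute) simp

lemma cinner_self_eq_zero [simp]: "cinner x x = 0 \<longleftrightarrow> (x::'a::chilbert) = 0"
  by (simp add: cinner_self)

lemma power2_norm_add: "(norm (x + y))\<^sup>2 = (norm x)\<^sup>2 + 2 * Re (cinner x y) + (norm (y::'a::chilbert))\<^sup>2"
proof -
  have "(norm (x + y))\<^sup>2 = Re (cinner (x + y) (x + y))"
    by (simp only: cinner_self Re_complex_of_real)
  also have "\<dots> = Re (cinner x x) + 2 * Re (cinner x y) + Re (cinner y y)"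
    using Re_cinner_commute[of x y] by (simp add: cinner_add_left cinner_add_right)
  finally show ?thesis
    by (simp only: cinner_self Re_complex_of_real)
qed

lemma power2_norm_diff: "(norm (x - y))\<^sup>2 = (norm x)\<^sup>2 - 2 * Re (cinner x y) + (norm (y::'a::chilbert))\<^sup>2"
  using power2_norm_add[of x "- y"] by (simp add: cinner_minus_right)

text \<open>For small t the linear term dominates. This is the first-order condition behind both the
  orthogonality of a nearest point and the vanishing of a positive form.\<close>

lemma quadratic_nonneg_imp_linear_zero:
  fixes a b :: real
  assumes "\<And>t. 0 \<le> 2 * t * a + t\<^sup>2 * b"
  shows "a = 0"
proof (rule ccontr)
  assume "a \<noteq> 0"
  \<comment> \<open>The sign is opposite to that of \<open>a\<close>, and the size makes the
    quadratic term at most \<open>- t * a\<close>, half of what the linear term takes away.\<close>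
  define t where "t = - a / (1 + \<bar>b\<bar>)"
  have "t\<^sup>2 * b \<le> t\<^sup>2 * (1 + \<bar>b\<bar>)"
    by (intro mult_left_mono) auto
  also have "\<dots> = - t * a"
    unfolding t_def by (simp add: power2_eq_square divide_simps)
  finally have "0 \<le> t * a"
    using assms[of t] by simp
  moreover have "t * a = - (a\<^sup>2 / (1 + \<bar>b\<bar>))"
    unfolding t_def by (simp add: power2_eq_square)
  moreover have "a\<^sup>2 / (1 + \<bar>b\<bar>) > 0"
    using \<open>a \<noteq> 0\<close> by (intro divide_pos_pos) auto
  ultimately show False by simp
qed

lemma Re_cinner_le: "Re (cinner x y) \<le> norm x * norm (y::'a::chilbert)"
proof (cases "x = 0 \<or> y = 0")
  case False
  \<comment> \<open>Both vectors are scaled to the same length \<open>norm x * norm y\<close>, so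
    that the expanded square factors.\<close>
  have "0 \<le> (norm (norm y *\<^sub>R x - norm x *\<^sub>R y))\<^sup>2" by simp
  also have "\<dots> = 2 * (norm x * norm y) * (norm x * norm y - Re (cinner x y))"
    unfolding power2_norm_diff
    by (simp add: cinner_scaleR_left cinner_scaleR_right power2_eq_square algebra_simps)
  finally show ?thesis
    using False by (simp add: zero_le_mult_iff mult_le_0_iff)
qed auto

lemma norm_scaleC: "norm (scaleC c (x::'a::chilbert)) = norm c * norm x"
proof -
  have "complex_of_real ((norm (scaleC c x))\<^sup>2) = c * cnj c * complex_of_real ((norm x)\<^sup>2)"
    by (simp only: cinner_self[symmetric] cinner_scaleC_left cinner_scaleC_right mult_ac)
  also have "\<dots> = complex_of_real ((norm c * norm x)\<^sup>2)"
    by (simp only: complex_norm_square[symmetric] power_mult_distrib of_real_mult of_real_power)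
  finally have "(norm (scaleC c x))\<^sup>2 = (norm c * norm x)\<^sup>2"
    by (simp only: of_real_eq_iff)
  then show ?thesis by simp
qed

lemma norm_cinner_le: "norm (cinner x y) \<le> norm x * norm (y::'a::chilbert)"
proof (cases "cinner x y = 0")
  case False
  \<comment> \<open>A phase that rotates the inner product onto the nonnegative real axis, where the
    bound on real parts applies.\<close>
  define c where "c = cnj (cinner x y) / of_real (norm (cinner x y))"
  have "norm c = 1"
    using False by (simp add: c_def norm_divide)
  have eq: "c * cinner x y = of_real (norm (cinner x y))"
  proof -
    have "cnj (cinner x y) * cinner x y = (of_real (norm (cinner x y)))\<^sup>2"
      by (metis complex_norm_square mult.commute of_real_power)
    then show ?thesis
      using False by (simp add: c_def power2_eq_square)
  qed
  have "norm (scaleC c y) = norm y"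
    using \<open>norm c = 1\<close> by (simp add: norm_scaleC)
  then show ?thesis
    using Re_cinner_le[of x "scaleC c y"] eq by (simp add: cinner_scaleC_right)
qed simp

lemma bounded_bilinear_cinner: "bounded_bilinear (cinner :: 'a::chilbert \<Rightarrow> 'a \<Rightarrow> complex)"
proof
  show "\<exists>K. \<forall>a b::'a. norm (cinner a b) \<le> norm a * norm b * K"
    by (rule exI[of _ 1]) (simp add: norm_cinner_le)
qed (simp_all add: cinner_simps scaleR_conv_of_real)

lemmas tendsto_cinner = bounded_bilinear.tendsto[OF bounded_bilinear_cinner]

lemma cinner_ext: "(\<And>z. cinner z x = cinner z y) \<Longrightarrow> x = (y::'a::chilbert)"
  by (metis cinner_diff_right cinner_self_eq_zero right_minus_eq)

section \<open>Orthogonal complements, closed subspaces and projections\<close>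

lemma orthI: "(\<And>x. x \<in> S \<Longrightarrow> cinner x y = 0) \<Longrightarrow> y \<in> orth S"
  by (simp add: orth_def)

lemma orthD: "y \<in> orth S \<Longrightarrow> x \<in> S \<Longrightarrow> cinner x y = 0"
  by (simp add: orth_def)

lemma orthD2: "y \<in> orth S \<Longrightarrow> x \<in> S \<Longrightarrow> cinner y x = 0"
  by (subst cinner_eq_zero_commute) (rule orthD)

lemma orth_antimono: "A \<subseteq> B \<Longrightarrow> orth B \<subseteq> orth A"
  by (auto simp: orth_def)

lemma subset_orth_orth: "S \<subseteq> orth (orth S)"
  by (auto intro!: orthI dest: orthD2)

lemma orth_orth_orth [simp]: "orth (orth (orth S)) = orth S"
  by (meson orth_antimono subset_antisym subset_orth_orth)

lemma range_in_orth_orth: "K x \<in> orth (orth (range K))"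
  by (rule subsetD[OF subset_orth_orth rangeI])

lemma orth_disjoint: "x \<in> S \<Longrightarrow> x \<in> orth S \<Longrightarrow> x = 0"
  using orthD[of x S x] by simp

definition csubspace :: "'a::chilbert set \<Rightarrow> bool" where
  "csubspace S \<longleftrightarrow> 0 \<in> S \<and> (\<forall>x\<in>S. \<forall>y\<in>S. x + y \<in> S) \<and> (\<forall>c. \<forall>x\<in>S. scaleC c x \<in> S)"

lemma csubspaceI:
  assumes "0 \<in> S" "\<And>x y. x \<in> S \<Longrightarrow> y \<in> S \<Longrightarrow> x + y \<in> S" "\<And>c x. x \<in> S \<Longrightarrow> scaleC c x \<in> S"
  shows "csubspace S"
  using assms by (auto simp: csubspace_def)

lemma csubspace_0: "csubspace S \<Longrightarrow> 0 \<in> S"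
  and csubspace_add: "csubspace S \<Longrightarrow> x \<in> S \<Longrightarrow> y \<in> S \<Longrightarrow> x + y \<in> S"
  and csubspace_scaleC: "csubspace S \<Longrightarrow> x \<in> S \<Longrightarrow> scaleC c x \<in> S"
  by (auto simp: csubspace_def)

lemma csubspace_scaleR: "csubspace S \<Longrightarrow> x \<in> S \<Longrightarrow> r *\<^sub>R x \<in> S"
  by (metis csubspace_scaleC scaleC_of_real)

lemma csubspace_diff: "csubspace S \<Longrightarrow> x \<in> S \<Longrightarrow> y \<in> S \<Longrightarrow> x - y \<in> S"
  using csubspace_add[of S x "- y"] csubspace_scaleR[of S y "-1"] by simp

lemma csubspace_orth: "csubspace (orth S)"
  by (rule csubspaceI) (auto simp: orth_def cinner_simps)

lemma zero_in_orth [simp]: "0 \<in> orth S"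
  by (rule csubspace_0[OF csubspace_orth])

lemma scaleC_zero_right [simp]: "scaleC c (0::'a::chilbert) = 0"
  using scaleC_add_right[of c 0 "0::'a"] by simp

lemma bounded_linear_scaleC: "bounded_linear (scaleC c :: 'a::chilbert \<Rightarrow> 'a)"
proof (rule bounded_linear_intro)
  show "scaleC c (r *\<^sub>R x) = r *\<^sub>R scaleC c x" for r and x :: 'a
    by (metis mult.commute scaleC_of_real scaleC_scaleC)
  show "norm (scaleC c x) \<le> norm x * norm c" for x :: 'a
    by (simp add: norm_scaleC)
qed (simp add: scaleC_add_right)

lemma csubspace_closure:
  assumes "csubspace S" shows "csubspace (closure S)"
proof (rule csubspaceI)
  show "0 \<in> closure S"
    using csubspace_0[OF assms] closure_subset by blast
next
  fix x y assume "x \<in> closure S" "y \<in> closure S"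
  then obtain f g where "\<And>n. f n \<in> S" "f \<longlonglongrightarrow> x" "\<And>n. g n \<in> S" "g \<longlonglongrightarrow> y"
    unfolding closure_sequential by blast
  then show "x + y \<in> closure S"
    unfolding closure_sequential
    by (intro exI[of _ "\<lambda>n. f n + g n"]) (auto intro: csubspace_add[OF assms] tendsto_add)
next
  fix c x assume "x \<in> closure S"
  then obtain f where "\<And>n. f n \<in> S" "f \<longlonglongrightarrow> x"
    unfolding closure_sequential by blast
  then show "scaleC c x \<in> closure S"
    unfolding closure_sequential
    by (intro exI[of _ "\<lambda>n. scaleC c (f n)"])
       (auto intro: csubspace_scaleC[OF assms] bounded_linear.tendsto[OF bounded_linear_scaleC])
qed

text \<open>A minimizing sequence is Cauchy by the parallelogram law: the midpoint of two of its
  members stays in \<open>S\<close>, so its distance from \<open>x\<close> is at least the infimum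
  \<open>d\<close>.\<close>

lemma closed_csubspace_nearest_point:
  fixes x :: "'a::chilbert"
  assumes S: "csubspace S" "closed S"
  obtains m where "m \<in> S" "\<And>s. s \<in> S \<Longrightarrow> norm (x - m) \<le> norm (x - s)"
proof -
  define d where "d = (INF s\<in>S. norm (x - s))"
  have bdd: "bdd_below ((\<lambda>s. norm (x - s)) ` S)"
    by (rule bdd_belowI[of _ 0]) auto
  have d_le: "d \<le> norm (x - s)" if "s \<in> S" for s
    unfolding d_def using bdd that by (rule cINF_lower)
  have "d \<ge> 0"
    unfolding d_def using csubspace_0[OF S(1)] by (intro cINF_greatest) auto
  have "\<exists>s\<in>S. norm (x - s) < d + 1 / Suc n" for n
    using cINF_less_iff[OF _ bdd, of "d + 1 / Suc n"] csubspace_0[OF S(1)]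
    by (auto simp: d_def)
  then obtain f where fS: "\<And>n. f n \<in> S" and f: "\<And>n. norm (x - f n) < d + 1 / Suc n"
    by metis
  have lim: "(\<lambda>n. norm (x - f n)) \<longlonglongrightarrow> d"
  proof (rule tendsto_sandwich[of "\<lambda>_. d" _ _ "\<lambda>n. d + 1 / Suc n"])
    show "(\<lambda>n. d + 1 / Suc n) \<longlonglongrightarrow> d"
      using tendsto_add[OF tendsto_const[of d] LIMSEQ_inverse_real_of_nat]
      by (simp add: inverse_eq_divide)
  qed (simp_all del: of_nat_Suc add: d_le fS less_imp_le[OF f])
  have para: "(norm (f m - f n))\<^sup>2 \<le> 2 * ((norm (x - f m))\<^sup>2 - d\<^sup>2) + 2 * ((norm (x - f n))\<^sup>2 - d\<^sup>2)"
    for m n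
  proof -
    let ?a = "x - f m" and ?b = "x - f n"
    have "?a + ?b = 2 *\<^sub>R (x - (1/2) *\<^sub>R (f m + f n))"
      by (simp add: algebra_simps scaleR_2)
    moreover have "d \<le> norm (x - (1/2) *\<^sub>R (f m + f n))"
      by (intro d_le csubspace_scaleR csubspace_add S fS)
    ultimately have "2 * d \<le> norm (?a + ?b)"
      by (metis mult_le_cancel_left_pos norm_scaleR abs_numeral zero_less_numeral)
    then have "(2 * d)\<^sup>2 \<le> (norm (?a + ?b))\<^sup>2"
      using \<open>d \<ge> 0\<close> by (intro power_mono) auto
    moreover have "f m - f n = ?b - ?a" by simp
    ultimately show ?thesis
      using power2_norm_add[of ?a ?b] power2_norm_diff[of ?b ?a] Re_cinner_commute[of ?a ?b]
      by (simp add: power_mult_distrib)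
  qed
  have lim2: "(\<lambda>n. (norm (x - f n))\<^sup>2 - d\<^sup>2) \<longlonglongrightarrow> 0"
    using tendsto_diff[OF tendsto_power[OF lim, of 2] tendsto_const[of "d\<^sup>2"]] by simp
  have "Cauchy f"
  proof (rule metric_CauchyI)
    fix e :: real assume "e > 0"
    then have "eventually (\<lambda>n. (norm (x - f n))\<^sup>2 - d\<^sup>2 < e\<^sup>2 / 4) sequentially"
      by (intro order_tendstoD(2)[OF lim2]) simp
    then obtain M where M: "\<And>n. n \<ge> M \<Longrightarrow> (norm (x - f n))\<^sup>2 - d\<^sup>2 < e\<^sup>2 / 4"
      unfolding eventually_sequentially by blast
    have "dist (f m) (f n) < e" if "m \<ge> M" "n \<ge> M" for m n
    proof -
      have "(norm (f m - f n))\<^sup>2 < e\<^sup>2"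
        using para[of m n] M[OF that(1)] M[OF that(2)] by (simp add: field_simps)
      then show ?thesis
        using \<open>e > 0\<close> by (simp add: dist_norm power_less_imp_less_base)
    qed
    then show "\<exists>M. \<forall>m\<ge>M. \<forall>n\<ge>M. dist (f m) (f n) < e" by blast
  qed
  then obtain m where m: "f \<longlonglongrightarrow> m"
    using Cauchy_convergent convergent_def by blast
  show ?thesis
  proof
    show "m \<in> S"
      using closed_sequentially[OF S(2) fS m] .
    have "(\<lambda>n. norm (x - f n)) \<longlonglongrightarrow> norm (x - m)"
      by (intro tendsto_intros m)
    then have "norm (x - m) = d"
      using lim LIMSEQ_unique by blast
    then show "norm (x - m) \<le> norm (x - s)" if "s \<in> S" for s
      using d_le[OF that] by simp
  qed
qed

theorem orthogonal_projection_exists: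
  fixes x :: "'a::chilbert"
  assumes S: "csubspace S" "closed S"
  obtains m n where "m \<in> S" "n \<in> orth S" "x = m + n"
proof -
  obtain m where m: "m \<in> S" "\<And>s. s \<in> S \<Longrightarrow> norm (x - m) \<le> norm (x - s)"
    using closed_csubspace_nearest_point[OF S, of x] by blast
  have "cinner s (x - m) = 0" if "s \<in> S" for s
  proof -
    \<comment> \<open>Moving \<open>m\<close> along \<open>scaleC c s\<close> rather than
      \<open>s\<close> makes the linear coefficient of the squared distance real, namely the square
      of \<open>norm c\<close>.\<close>
    define c where "c = cinner s (x - m)"
    have sq: "c * cnj c = of_real ((norm c)\<^sup>2)"
      by (simp only: complex_norm_square)
    have "0 \<le> 2 * t * (norm c)\<^sup>2 + t\<^sup>2 * (norm (scaleC c s))\<^sup>2" for t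
    proof -
      let ?s = "(- t) *\<^sub>R scaleC c s"
      have "norm (x - m) \<le> norm ((x - m) - ?s)"
        using m(2)[OF csubspace_add[OF S(1) m(1) csubspace_scaleR[OF S(1) csubspace_scaleC[OF S(1) that]]]]
        by (simp only: diff_diff_eq)
      then have "(norm (x - m))\<^sup>2 \<le> (norm ((x - m) - ?s))\<^sup>2"
        by (intro power_mono) auto
      moreover have "cinner (x - m) (scaleC c s) = of_real ((norm c)\<^sup>2)"
        using sq by (metis c_def cinner_commute cinner_scaleC_right)
      then have "Re (cinner (x - m) ?s) = - t * (norm c)\<^sup>2"
        by (simp only: cinner_scaleR_right of_real_mult[symmetric] Re_complex_of_real)
      ultimately show ?thesis
        unfolding power2_norm_diff[of "x - m" ?s] by (simp add: power_mult_distrib)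
    qed
    then have "(norm c)\<^sup>2 = 0"
      by (rule quadratic_nonneg_imp_linear_zero)
    then show ?thesis
      by (simp add: c_def)
  qed
  then show ?thesis
    using m(1) that[of m "x - m"] by (simp add: orthI)
qed

lemma orth_orth_closed_csubspace:
  assumes "csubspace S" "closed S" shows "orth (orth S) = S"
proof (rule antisym)
  show "orth (orth S) \<subseteq> S"
  proof
    fix x assume x: "x \<in> orth (orth S)"
    obtain m n where mn: "m \<in> S" "n \<in> orth S" "x = m + n"
      by (rule orthogonal_projection_exists[OF assms, of x])
    have "n = x - m" using mn by simp
    then have "n \<in> orth (orth S)"
      using csubspace_diff[OF csubspace_orth x] mn(1) subset_orth_orth by auto
    then have "n = 0"
      using orth_disjoint mn(2) by blast
    then show "x \<in> S" using mn by simp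
  qed
qed (rule subset_orth_orth)

lemma closed_orth: "closed (orth S)"
  unfolding closed_sequential_limits
proof (intro allI impI, elim conjE)
  fix f l assume f: "\<forall>n. f n \<in> orth S" and l: "f \<longlonglongrightarrow> l"
  show "l \<in> orth S"
  proof (rule orthI)
    fix x assume "x \<in> S"
    then have "(\<lambda>n. cinner x (f n)) = (\<lambda>n. 0)"
      using f orthD by blast
    then show "cinner x l = 0"
      using tendsto_cinner[OF tendsto_const l, of x] LIMSEQ_unique[OF tendsto_const] by metis
  qed
qed

lemma orth_closure: "orth (closure S) = orth S"
proof (rule antisym)
  have "S \<subseteq> orth (orth S)" by (rule subset_orth_orth)
  then have "closure S \<subseteq> orth (orth S)"
    by (rule closure_minimal) (rule closed_orth)
  then show "orth S \<subseteq> orth (closure S)"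
    using orth_antimono orth_orth_orth by metis
qed (rule orth_antimono[OF closure_subset])

text \<open>A set and its closure have the same complement, and a closed subspace is recovered from
  its complement.\<close>

lemma dense_iff_orth_trivial:
  assumes "csubspace S"
  shows "closure S = UNIV \<longleftrightarrow> orth S = {0}"
proof
  assume "closure S = UNIV"
  then have "orth S = orth UNIV"
    by (metis orth_closure)
  then show "orth S = {0}"
    using orth_disjoint[of _ UNIV] by auto
next
  assume "orth S = {0}"
  then have "orth (orth (closure S)) = UNIV"
    by (simp add: orth_closure) (simp add: orth_def)
  then show "closure S = UNIV"
    using orth_orth_closed_csubspace[OF csubspace_closure[OF assms] closed_closure] by simp
qed

subsection \<open>Adjoints and positive square roots of bounded operators\<close>

text \<open>Bounded operators are carried as plain functions together with an adjoint. Linearity of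
  both maps follows from the identity by testing against all vectors, so it is not part of the
  definition.\<close>

definition adjoint_pair :: "('a::chilbert \<Rightarrow> 'a) \<Rightarrow> ('a \<Rightarrow> 'a) \<Rightarrow> bool" where
  "adjoint_pair K W \<longleftrightarrow> (\<forall>x y. cinner (K x) y = cinner x (W y))"

lemma adjoint_pairD: "adjoint_pair K W \<Longrightarrow> cinner (K x) y = cinner x (W y)"
  by (simp add: adjoint_pair_def)

lemma adjoint_pair_sym: "adjoint_pair K W \<Longrightarrow> adjoint_pair W K"
  unfolding adjoint_pair_def by (metis cinner_commute)

lemma adjoint_pair_comp:
  "adjoint_pair K W \<Longrightarrow> adjoint_pair L V \<Longrightarrow> adjoint_pair (\<lambda>x. K (L x)) (\<lambda>x. V (W x))"
  by (simp add: adjoint_pair_def)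

lemma adjoint_pair_add:
  assumes "adjoint_pair K W" shows "K (x + y) = K x + K y"
  by (rule cinner_ext)
     (simp add: adjoint_pairD[OF adjoint_pair_sym[OF assms], symmetric] cinner_add_right)

lemma adjoint_pair_scaleC:
  assumes "adjoint_pair K W" shows "K (scaleC c x) = scaleC c (K x)"
  by (rule cinner_ext)
     (simp add: adjoint_pairD[OF adjoint_pair_sym[OF assms], symmetric] cinner_scaleC_right)

lemma adjoint_pair_scaleR:
  assumes "adjoint_pair K W" shows "K (r *\<^sub>R x) = r *\<^sub>R K x"
  by (metis adjoint_pair_scaleC[OF assms] scaleC_of_real)

lemma adjoint_pair_zero: "adjoint_pair K W \<Longrightarrow> K 0 = 0"
  by (metis adjoint_pair_scaleR scaleR_zero_left)

lemma adjoint_pair_diff: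
  assumes "adjoint_pair K W" shows "K (x - y) = K x - K y"
  using adjoint_pair_add[OF assms, of "x - y" y] by simp

lemma adjoint_pair_kernel:
  assumes "adjoint_pair K W" shows "{x. K x = 0} = orth (range W)"
proof (intro set_eqI iffI)
  fix x assume "x \<in> orth (range W)"
  then have "cinner z (K x) = 0" for z
    using adjoint_pairD[OF adjoint_pair_sym[OF assms], of z x] by (simp add: orthD)
  then show "x \<in> {x. K x = 0}"
    by (metis cinner_self_eq_zero mem_Collect_eq)
next
  fix x assume "x \<in> {x. K x = 0}"
  then show "x \<in> orth (range W)"
    using adjoint_pairD[OF adjoint_pair_sym[OF assms], of _ x] by (auto intro: orthI)
qed

text \<open>Riesz representation for the conjugate-linear functional
  \<open>\<lambda>x. cinner (K x) y\<close>: the representing vector is a multiple of a vector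
  orthogonal to the kernel \<open>S\<close> of the functional.\<close>

lemma bounded_has_adjoint:
  fixes K :: "'a::chilbert \<Rightarrow> 'a"
  assumes K: "bounded_linear K" and KC: "\<And>c x. K (scaleC c x) = scaleC c (K x)"
  obtains W where "adjoint_pair K W"
proof -
  have "\<exists>z. \<forall>x. cinner (K x) y = cinner x z" for y
  proof (cases "\<forall>x. cinner (K x) y = 0")
    case False
    define S where "S = {x. cinner (K x) y = 0}"
    have "csubspace S"
      unfolding S_def
      by (rule csubspaceI)
         (auto simp: linear_simps[OF K] KC cinner_add_left cinner_scaleC_left)
    moreover have "closed S"
      unfolding closed_sequential_limits
    proof (intro allI impI, elim conjE)
      fix f l assume f: "\<forall>n. f n \<in> S" and l: "f \<longlonglongrightarrow> l"
      have "(\<lambda>n. cinner (K (f n)) y) \<longlonglongrightarrow> cinner (K l) y"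
        by (intro tendsto_cinner tendsto_const bounded_linear.tendsto[OF K] l)
      then show "l \<in> S"
        using f by (simp add: S_def LIMSEQ_const_iff)
    qed
    ultimately have proj: "\<exists>m n. m \<in> S \<and> n \<in> orth S \<and> x = m + n" for x
      by (metis orthogonal_projection_exists)
    obtain x0 where "cinner (K x0) y \<noteq> 0"
      using False by blast
    moreover obtain m r where m: "m \<in> S" and r: "r \<in> orth S" and "x0 = m + r"
      using proj by blast
    ultimately have a: "cinner (K r) y \<noteq> 0"
      by (simp add: S_def linear_simps[OF K] cinner_add_left)
    then have "r \<noteq> 0"
      using linear_simps[OF K] by auto
    define a where "a = cinner (K r) y"
    \<comment> \<open>The factor is forced by \<open>cinner r z = cinner (K r) y\<close>.\<close>
    define z where "z = scaleC (a / of_real ((norm r)\<^sup>2)) r"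
    have "cinner (K x) y = cinner x z" for x
    proof -
      \<comment> \<open>Chosen to put \<open>x - scaleC k r\<close> into the kernel; the conjugate
        compensates for conjugate-linearity in the first argument.\<close>
      define k where "k = cnj (cinner (K x) y / a)"
      have "x - scaleC k r \<in> S"
        using a by (simp add: S_def linear_simps[OF K] KC cinner_diff_left cinner_scaleC_left k_def a_def)
      then have "cinner (x - scaleC k r) r = 0"
        using r by (simp add: orthD)
      then have "cinner x r = (cinner (K x) y / a) * of_real ((norm r)\<^sup>2)"
        by (simp add: cinner_diff_left cinner_scaleC_left k_def cinner_self)
      then show ?thesis
        using \<open>r \<noteq> 0\<close> a by (simp add: z_def cinner_scaleC_right a_def)
    qed
    then show ?thesis by blast
  qed (auto intro: exI[of _ 0])
  then obtain W where "\<forall>y x. cinner (K x) y = cinner x (W y)"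
    by metis
  then have "adjoint_pair K W"
    by (simp add: adjoint_pair_def)
  then show ?thesis by (rule that)
qed

section \<open>Positive square roots of bounded operators\<close>

text \<open>The form attains its minimum 0 at \<open>x\<close>, so its derivative in the direction
  \<open>Q x\<close> vanishes; that derivative is twice the square of
  \<open>norm (Q x)\<close>.\<close>

lemma positive_form_zero:
  assumes Q: "adjoint_pair Q Q" and pos: "\<And>x. 0 \<le> Re (cinner (Q x) x)"
    and zero: "Re (cinner (Q x) x) = 0"
  shows "Q x = 0"
proof -
  have "0 \<le> 2 * t * (norm (Q x))\<^sup>2 + t\<^sup>2 * Re (cinner (Q (Q x)) (Q x))" for t
  proof -
    have "cinner (Q (Q x)) x = cinner (Q x) (Q x)"
      by (rule adjoint_pairD[OF Q])
    moreover have "cinner (Q x) (Q x) = of_real ((norm (Q x))\<^sup>2)"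
      by (rule cinner_self)
    ultimately show ?thesis
      using pos[of "x + t *\<^sub>R Q x"] zero
      by (simp add: adjoint_pair_add[OF Q] adjoint_pair_scaleR[OF Q] cinner_add_left cinner_add_right
          cinner_scaleR_left cinner_scaleR_right power2_eq_square algebra_simps)
  qed
  then have "(norm (Q x))\<^sup>2 = 0"
    by (rule quadratic_nonneg_imp_linear_zero)
  then show ?thesis by simp
qed

text \<open>Commutation factors Q Q - R R as (Q + R)(Q - R), so Q + R annihilates y = Q x - R x.
  Positivity then kills \<open>Q y\<close> and \<open>R y\<close> separately, and moving Q and R
  across the inner product shows that y is orthogonal to itself.\<close>

lemma commuting_positive_sqrt_unique:
  assumes Q: "adjoint_pair Q Q" "\<And>x. 0 \<le> Re (cinner (Q x) x)"
    and R: "adjoint_pair R R" "\<And>x. 0 \<le> Re (cinner (R x) x)"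
    and sq: "\<And>x. Q (Q x) = R (R x)" and comm: "\<And>x. Q (R x) = R (Q x)"
  shows "Q = R"
proof
  fix x
  define y where "y = Q x - R x"
  have "Q y + R y = 0"
    by (simp add: y_def adjoint_pair_diff[OF Q(1)] adjoint_pair_diff[OF R(1)] sq comm)
  then have "Re (cinner (Q y) y) + Re (cinner (R y) y) = 0"
    by (metis cinner_add_left cinner_zero_left plus_complex.simps(1) zero_complex.simps(1))
  then have "Re (cinner (Q y) y) = 0" "Re (cinner (R y) y) = 0"
    using Q(2)[of y] R(2)[of y] by linarith+
  then have "Q y = 0" "R y = 0"
    using positive_form_zero[OF Q] positive_form_zero[OF R] by blast+
  then have "cinner y y = 0"
    using adjoint_pairD[OF Q(1), of x y] adjoint_pairD[OF R(1), of x y]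
    by (subst y_def) (simp add: cinner_diff_left)
  then show "Q x = R x"
    by (simp add: y_def)
qed

text \<open>The fixed point \<open>Y = (B + Y\<^sup>2) / 2\<close> gives \<open>(1 - Y)\<^sup>2 = 1 - B\<close>. The iterates and their increments are
  dominated in norm by those of the scalar iteration with \<open>B = 1\<close>, hence converge even for \<open>\<parallel>B\<parallel> = 1\<close>.\<close>

primrec sqrt_iter :: "('a::real_normed_vector \<Rightarrow>\<^sub>L 'a) \<Rightarrow> nat \<Rightarrow> ('a \<Rightarrow>\<^sub>L 'a)" where
  "sqrt_iter B 0 = 0"
| "sqrt_iter B (Suc n) = (1/2) *\<^sub>R (B + (sqrt_iter B n o\<^sub>L sqrt_iter B n))"

primrec sqrt_iter_bound :: "nat \<Rightarrow> real" where
  "sqrt_iter_bound 0 = 0"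
| "sqrt_iter_bound (Suc n) = (1 + (sqrt_iter_bound n)\<^sup>2) / 2"

lemma sqrt_iter_bound_range: "0 \<le> sqrt_iter_bound n" "sqrt_iter_bound n \<le> 1"
proof (induction n)
  case (Suc n)
  { case 1 show ?case by simp }
  { case 2 show ?case using power_le_one[OF Suc.IH(1) Suc.IH(2), of 2] by simp }
qed auto

lemma norm_sqrt_iter_le:
  assumes "norm B \<le> 1" shows "norm (sqrt_iter B n) \<le> sqrt_iter_bound n"
proof (induction n)
  case (Suc n)
  have "norm (sqrt_iter B n o\<^sub>L sqrt_iter B n) \<le> norm (sqrt_iter B n) * norm (sqrt_iter B n)"
    by (rule norm_blinfun_compose)
  also have "\<dots> \<le> sqrt_iter_bound n * sqrt_iter_bound n"
    by (intro mult_mono Suc sqrt_iter_bound_range norm_ge_zero)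
  finally show ?case
    using assms norm_triangle_ineq[of B "sqrt_iter B n o\<^sub>L sqrt_iter B n"]
    by (simp add: power2_eq_square)
qed simp

text \<open>The difference of squares X X - Y Y splits as X (X - Y) + (X - Y) Y without any
  commutation, and the same splitting is exact for the scalar sequence, so the domination
  propagates.\<close>

lemma norm_sqrt_iter_step:
  assumes "norm B \<le> 1"
  shows "norm (sqrt_iter B (Suc n) - sqrt_iter B n) \<le> sqrt_iter_bound (Suc n) - sqrt_iter_bound n"
proof (induction n)
  case 0
  then show ?case using assms by simp
next
  case (Suc n)
  let ?X = "sqrt_iter B (Suc n)" and ?Y = "sqrt_iter B n"
  let ?x = "sqrt_iter_bound (Suc n)" and ?y = "sqrt_iter_bound n"
  have eq: "sqrt_iter B (Suc (Suc n)) - ?X = (1/2) *\<^sub>R ((?X o\<^sub>L (?X - ?Y)) + ((?X - ?Y) o\<^sub>L ?Y))"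
  proof -
    have "sqrt_iter B (Suc (Suc n)) - ?X
        = (1/2) *\<^sub>R (B + (?X o\<^sub>L ?X)) - (1/2) *\<^sub>R (B + (?Y o\<^sub>L ?Y))"
      by (intro arg_cong2[where f = "(-)"] sqrt_iter.simps(2))
    also have "\<dots> = (1/2) *\<^sub>R ((?X o\<^sub>L (?X - ?Y)) + ((?X - ?Y) o\<^sub>L ?Y))"
      by (rule blinfun_eqI) (simp add: blinfun.bilinear_simps algebra_simps del: sqrt_iter.simps)
    finally show ?thesis .
  qed
  have "norm ((?X o\<^sub>L (?X - ?Y)) + ((?X - ?Y) o\<^sub>L ?Y))
      \<le> norm (?X o\<^sub>L (?X - ?Y)) + norm ((?X - ?Y) o\<^sub>L ?Y)"
    by (rule norm_triangle_ineq)
  also have "\<dots> \<le> norm ?X * norm (?X - ?Y) + norm (?X - ?Y) * norm ?Y"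
    by (intro add_mono norm_blinfun_compose)
  also have "\<dots> \<le> ?x * (?x - ?y) + (?x - ?y) * ?y"
    using order_trans[OF norm_ge_zero Suc]
    by (intro add_mono mult_mono Suc norm_sqrt_iter_le[OF assms] sqrt_iter_bound_range norm_ge_zero)
  also have "\<dots> = 2 * (sqrt_iter_bound (Suc (Suc n)) - ?x)"
  proof -
    have "sqrt_iter_bound (Suc (Suc n)) - ?x = (1 + ?x\<^sup>2) / 2 - (1 + ?y\<^sup>2) / 2"
      by (intro arg_cong2[where f = "(-)"] sqrt_iter_bound.simps(2))
    then have "2 * (sqrt_iter_bound (Suc (Suc n)) - ?x) = ?x\<^sup>2 - ?y\<^sup>2"
      by (simp add: field_simps del: sqrt_iter_bound.simps)
    then show ?thesis
      by (simp add: power2_eq_square algebra_simps del: sqrt_iter_bound.simps)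
  qed
  finally show ?case
    unfolding eq by (simp del: sqrt_iter.simps sqrt_iter_bound.simps)
qed

lemma sqrt_iter_convergent:
  fixes B :: "'a::banach \<Rightarrow>\<^sub>L 'a"
  assumes "norm B \<le> 1" shows "convergent (sqrt_iter B)"
proof -
  have "summable (\<lambda>n. sqrt_iter_bound (Suc n) - sqrt_iter_bound n)"
  proof (rule summableI_nonneg_bounded)
    fix n
    show "0 \<le> sqrt_iter_bound (Suc n) - sqrt_iter_bound n"
      \<comment> \<open>The increment equals half the square of
        \<open>sqrt_iter_bound n - 1\<close>.\<close>
      using zero_le_power2[of "sqrt_iter_bound n - 1"] by (simp add: power2_eq_square algebra_simps)
    show "(\<Sum>i<n. sqrt_iter_bound (Suc i) - sqrt_iter_bound i) \<le> 1"
      unfolding sum_lessThan_telescope using sqrt_iter_bound_range[of n] by simp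
  qed
  then have "summable (\<lambda>n. sqrt_iter B (Suc n) - sqrt_iter B n)"
    by (rule summable_comparison_test') (rule norm_sqrt_iter_step[OF assms])
  then have "convergent (\<lambda>n. sqrt_iter B n - sqrt_iter B 0)"
    unfolding summable_iff_convergent sum_lessThan_telescope .
  then show ?thesis by simp
qed

lemma adjoint_pair_sqrt_iter:
  fixes B :: "'a::chilbert \<Rightarrow>\<^sub>L 'a"
  assumes "adjoint_pair B B" shows "adjoint_pair (sqrt_iter B n) (sqrt_iter B n)"
proof (induction n)
  case (Suc n)
  have "adjoint_pair (\<lambda>x. sqrt_iter B n (sqrt_iter B n x)) (\<lambda>x. sqrt_iter B n (sqrt_iter B n x))"
    using Suc by (rule adjoint_pair_comp[OF _ Suc])
  then show ?case
    using assms
    by (simp add: adjoint_pair_def blinfun.bilinear_simps cinner_scaleR_left cinner_scaleR_right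
        cinner_add_left cinner_add_right)
qed (simp add: adjoint_pair_def)

text \<open>The iterates are polynomials in \<open>B\<close>.\<close>

lemma sqrt_iter_commute:
  fixes B :: "'a::chilbert \<Rightarrow>\<^sub>L 'a"
  assumes Q: "adjoint_pair Q Q'" and "\<And>x. Q (B x) = B (Q x)"
  shows "Q (sqrt_iter B n x) = sqrt_iter B n (Q x)"
proof (induction n arbitrary: x)
  case (Suc n)
  then show ?case
    using assms(2)
    by (simp add: blinfun.bilinear_simps adjoint_pair_scaleR[OF Q] adjoint_pair_add[OF Q])
qed (simp add: adjoint_pair_zero[OF Q])

text \<open>The hypothesis on \<open>A\<close> is positivity and boundedness in one: it says exactly
  that 1 - A does not increase norms. With B = 1 - A and Y the limit of the iteration, the root is 1
  - Y. The commutation clause prepares the uniqueness of the root.\<close>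

lemma positive_contraction_sqrt:
  fixes A :: "'a::chilbert \<Rightarrow> 'a"
  assumes A: "adjoint_pair A A" and bd: "\<And>x. (norm (A x))\<^sup>2 \<le> 2 * Re (cinner (A x) x)"
  obtains R where "adjoint_pair R R" "\<And>x. 0 \<le> Re (cinner (R x) x)" "\<And>x. R (R x) = A x"
    "\<And>Q x. adjoint_pair Q Q \<Longrightarrow> (\<And>x. Q (A x) = A (Q x)) \<Longrightarrow> Q (R x) = R (Q x)"
proof -
  have contr: "norm (x - A x) \<le> norm x" for x
  proof (rule power2_le_imp_le)
    show "(norm (x - A x))\<^sup>2 \<le> (norm x)\<^sup>2"
      using bd[of x] Re_cinner_commute[of x "A x"] by (simp add: power2_norm_diff)
  qed simp
  have lin: "bounded_linear (\<lambda>x. x - A x)"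
    by (rule bounded_linear_intro[where K = 1])
       (use contr in \<open>auto simp: adjoint_pair_add[OF A] adjoint_pair_scaleR[OF A] algebra_simps\<close>)
  define B where "B = Blinfun (\<lambda>x. x - A x)"
  have B: "blinfun_apply B x = x - A x" for x
    unfolding B_def by (simp add: bounded_linear_Blinfun_apply[OF lin])
  have "norm B \<le> 1"
    by (rule norm_blinfun_bound) (simp_all add: B contr)
  have Badj: "adjoint_pair B B"
    using A by (simp add: adjoint_pair_def B cinner_diff_left cinner_diff_right)
  obtain Y where Y: "sqrt_iter B \<longlonglongrightarrow> Y"
    using sqrt_iter_convergent[OF \<open>norm B \<le> 1\<close>] by (auto simp: convergent_def)
  have Yx: "(\<lambda>n. sqrt_iter B n x) \<longlonglongrightarrow> Y x" for x
    by (rule bounded_linear.tendsto[OF _ Y]) (rule blinfun.bounded_linear_left)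
  have "norm Y \<le> 1"
    by (rule LIMSEQ_le_const2[OF tendsto_norm[OF Y]])
       (meson norm_sqrt_iter_le[OF \<open>norm B \<le> 1\<close>] order_trans sqrt_iter_bound_range(2))
  have "(\<lambda>n. sqrt_iter B (Suc n)) \<longlonglongrightarrow> (1/2) *\<^sub>R (B + (Y o\<^sub>L Y))"
    unfolding sqrt_iter.simps
    by (intro tendsto_intros Y bounded_bilinear.tendsto[OF bounded_bilinear_blinfun_compose])
  then have "Y = (1/2) *\<^sub>R (B + (Y o\<^sub>L Y))"
    using LIMSEQ_unique[OF LIMSEQ_Suc[OF Y]] by blast
  then have "2 *\<^sub>R Y = B + (Y o\<^sub>L Y)"
    by (metis (no_types, lifting) field_sum_of_halves mult_2 nonzero_mult_div_cancel_left
        scaleR_half_double scaleR_one scaleR_scaleR times_divide_eq_right zero_neq_numeral)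
  then have fixp: "2 *\<^sub>R Y x = (x - A x) + Y (Y x)" for x
    by (metis B blinfun.add_left blinfun.scaleR_left blinfun_apply_blinfun_compose)
  have Yadj: "cinner (Y x) y = cinner x (Y y)" for x y
  proof (rule LIMSEQ_unique)
    show "(\<lambda>n. cinner (sqrt_iter B n x) y) \<longlonglongrightarrow> cinner (Y x) y"
      by (intro tendsto_cinner tendsto_const Yx)
    show "(\<lambda>n. cinner (sqrt_iter B n x) y) \<longlonglongrightarrow> cinner x (Y y)"
      unfolding adjoint_pairD[OF adjoint_pair_sqrt_iter[OF Badj]]
      by (intro tendsto_cinner tendsto_const Yx)
  qed
  show ?thesis
  proof (rule that[of "\<lambda>x. x - Y x"])
    show "adjoint_pair (\<lambda>x. x - Y x) (\<lambda>x. x - Y x)"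
      by (simp add: adjoint_pair_def cinner_diff_left cinner_diff_right Yadj)
    show "0 \<le> Re (cinner (x - Y x) x)" for x
    proof -
      have "norm (Y x) \<le> norm x"
        using norm_blinfun[of Y x] \<open>norm Y \<le> 1\<close> mult_right_mono[of "norm Y" 1 "norm x"] by simp
      then have "Re (cinner (Y x) x) \<le> norm x * norm x"
        using Re_cinner_le[of "Y x" x] mult_right_mono[of "norm (Y x)" "norm x" "norm x"] by simp
      then show ?thesis
        by (simp add: cinner_diff_left cinner_self power2_eq_square)
    qed
    show "(x - Y x) - Y (x - Y x) = A x" for x
      using fixp[of x] by (simp add: blinfun.bilinear_simps algebra_simps scaleR_2)
    show "Q (x - Y x) = Q x - Y (Q x)"
      if Q: "adjoint_pair Q Q" and comm: "\<And>x. Q (A x) = A (Q x)" for Q x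
    proof -
      have commB: "Q (B z) = B (Q z)" for z
        by (simp add: B adjoint_pair_diff[OF Q] comm)
      have "Q (Y x) = Y (Q x)"
      \<comment> \<open>\<open>Q\<close> is not known to be continuous, so it is moved to the other
        side of the inner product before the limit is taken.\<close>
      proof (rule cinner_ext, rule LIMSEQ_unique)
        fix z
        show "(\<lambda>n. cinner (Q z) (sqrt_iter B n x)) \<longlonglongrightarrow> cinner z (Q (Y x))"
          unfolding adjoint_pairD[OF Q, symmetric] by (intro tendsto_cinner tendsto_const Yx)
        show "(\<lambda>n. cinner (Q z) (sqrt_iter B n x)) \<longlonglongrightarrow> cinner z (Y (Q x))"
          unfolding adjoint_pairD[OF Q] sqrt_iter_commute[OF Q commB]
          by (intro tendsto_cinner tendsto_const Yx)
      qed
      then show ?thesis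
        by (simp add: adjoint_pair_diff[OF Q])
    qed
  qed
qed

text \<open>Dividing by \<open>b\<close> reduces to the previous lemma, and \<open>sqrt b\<close>
  undoes the scaling. For uniqueness, any competitor \<open>Q\<close> commutes with its own square
  \<open>G\<close>, hence with the constructed root, and commuting positive roots agree.\<close>

lemma positive_sqrt_exists:
  fixes G :: "'a::chilbert \<Rightarrow> 'a"
  assumes G: "adjoint_pair G G" and "b > 0"
    and bd: "\<And>x. (norm (G x))\<^sup>2 \<le> b * Re (cinner (G x) x)"
  obtains R where "adjoint_pair R R" "\<And>x. 0 \<le> Re (cinner (R x) x)" "\<And>x. R (R x) = G x"
    "\<And>Q. adjoint_pair Q Q \<Longrightarrow> (\<And>x. 0 \<le> Re (cinner (Q x) x)) \<Longrightarrow> (\<And>x. Q (Q x) = G x) \<Longrightarrow> Q = R"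
proof -
  define A where "A x = (1 / b) *\<^sub>R G x" for x
  have "adjoint_pair A A"
    using G by (simp add: A_def adjoint_pair_def cinner_scaleR_left cinner_scaleR_right)
  moreover have "(norm (A x))\<^sup>2 \<le> 2 * Re (cinner (A x) x)" for x
  proof -
    have "(norm (A x))\<^sup>2 = (norm (G x))\<^sup>2 / b\<^sup>2"
      using \<open>b > 0\<close> by (simp add: A_def power_divide)
    also have "\<dots> \<le> b * Re (cinner (G x) x) / b\<^sup>2"
      by (intro divide_right_mono bd) simp
    also have "\<dots> = Re (cinner (A x) x)"
      using \<open>b > 0\<close> by (simp add: A_def cinner_scaleR_left power2_eq_square)
    finally show ?thesis
      using order_trans[OF zero_le_power2] by (smt (verit))
  qed
  ultimately obtain R0 where R0: "adjoint_pair R0 R0" "\<And>x. 0 \<le> Re (cinner (R0 x) x)"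
    "\<And>x. R0 (R0 x) = A x"
    and comm0: "\<And>Q x. adjoint_pair Q Q \<Longrightarrow> (\<And>x. Q (A x) = A (Q x)) \<Longrightarrow> Q (R0 x) = R0 (Q x)"
    using positive_contraction_sqrt[of A] by blast
  define R where "R x = sqrt b *\<^sub>R R0 x" for x
  have R: "adjoint_pair R R" "0 \<le> Re (cinner (R x) x)" "R (R x) = G x" for x
    using \<open>b > 0\<close> R0
    by (simp_all add: R_def adjoint_pair_def cinner_scaleR_left cinner_scaleR_right
        adjoint_pair_scaleR[OF R0(1)] A_def)
  have "Q = R" if Q: "adjoint_pair Q Q" "\<And>x. 0 \<le> Re (cinner (Q x) x)" "\<And>x. Q (Q x) = G x" for Q
  proof (rule commuting_positive_sqrt_unique[OF Q(1,2) R(1,2)])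
    show "Q (Q x) = R (R x)" for x
      by (simp add: Q(3) R(3))
    have "Q (A x) = A (Q x)" for x
      by (simp add: A_def adjoint_pair_scaleR[OF Q(1)] flip: Q(3))
    then show "Q (R x) = R (Q x)" for x
      by (simp add: R_def adjoint_pair_scaleR[OF Q(1)] comm0[OF Q(1)])
  qed
  with R show ?thesis using that by blast
qed

subsection \<open>Operators with closed range\<close>

lemma linop_0: "is_linop T \<Longrightarrow> (0, 0) \<in> T"
  and linop_add: "is_linop T \<Longrightarrow> (x, y) \<in> T \<Longrightarrow> (u, v) \<in> T \<Longrightarrow> (x + u, y + v) \<in> T"
  and linop_scaleC: "is_linop T \<Longrightarrow> (x, y) \<in> T \<Longrightarrow> (scaleC c x, scaleC c y) \<in> T"
  and linop_zero_unique: "is_linop T \<Longrightarrow> (0, y) \<in> T \<Longrightarrow> y = 0"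
  by (simp_all add: is_linop_def)

lemma linop_scaleR: "is_linop T \<Longrightarrow> (x, y) \<in> T \<Longrightarrow> (r *\<^sub>R x, r *\<^sub>R y) \<in> T"
  by (metis linop_scaleC scaleC_of_real)

lemma linop_diff: "is_linop T \<Longrightarrow> (x, y) \<in> T \<Longrightarrow> (u, v) \<in> T \<Longrightarrow> (x - u, y - v) \<in> T"
  using linop_add[of T x y "- u" "- v"] linop_scaleR[of T u v "-1"] by simp

lemma ran_opI: "(x, y) \<in> T \<Longrightarrow> y \<in> ran_op T"
  by (force simp: ran_op_def)

lemma ran_opE: "y \<in> ran_op T \<Longrightarrow> (\<And>x. (x, y) \<in> T \<Longrightarrow> P) \<Longrightarrow> P"
  by (auto simp: ran_op_def)

lemma csubspace_ran_op: "is_linop T \<Longrightarrow> csubspace (ran_op T)"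
  by (rule csubspaceI) (blast intro: ran_opI linop_0 linop_add linop_scaleC elim: ran_opE)+

lemma csubspace_dom_op:
  assumes "is_linop T" shows "csubspace (dom_op T)"
proof (rule csubspaceI)
  show "0 \<in> dom_op T"
    using linop_0[OF assms] by (force simp: dom_op_def)
  show "x + y \<in> dom_op T" if "x \<in> dom_op T" "y \<in> dom_op T" for x y
    using that linop_add[OF assms] by (force simp: dom_op_def)
  show "scaleC c x \<in> dom_op T" if "x \<in> dom_op T" for c x
    using that linop_scaleC[OF assms] by (force simp: dom_op_def)
qed

lemma csubspace_ker_op:
  assumes "is_linop T" shows "csubspace (ker_op T)"
  using linop_0[OF assms] linop_add[OF assms, of _ 0 _ 0] linop_scaleC[OF assms, of _ 0]
  by (intro csubspaceI) (auto simp: ker_op_def)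

lemma closed_ker_op:
  fixes T :: "'a::chilbert linop"
  assumes "closed T" shows "closed (ker_op T)"
proof -
  have "ker_op T = (\<lambda>x. (x, 0)) -` T"
    by (auto simp: ker_op_def)
  then show ?thesis
    using assms by (simp add: closed_vimage continuous_on_Pair continuous_on_const continuous_on_id)
qed

text \<open>Baire's theorem makes the closure of the image of some ball a neighbourhood in the range.\<close>

lemma closed_range_approximate_preimages:
  fixes T :: "'a::chilbert linop"
  assumes T: "is_linop T" and ran: "closed (ran_op T)"
  obtains C where "C \<ge> 0"
    "\<And>y. y \<in> ran_op T \<Longrightarrow> \<exists>x y'. (x, y') \<in> T \<and> norm x \<le> C * norm y \<and> norm (y - y') \<le> norm y / 2"
proof -
  define E where "E n = {y. \<exists>x. (x, y) \<in> T \<and> norm x \<le> real n}" for n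
  let ?X = "top_of_set (ran_op T)"
  have sub: "closure (E n) \<subseteq> ran_op T" for n
    by (rule closure_minimal) (auto simp: E_def ran intro: ran_opI)
  have "\<exists>n. ?X interior_of closure (E n) \<noteq> {}"
  proof (rule ccontr)
    assume "\<not> ?thesis"
    then have "?X interior_of \<Union> (range (\<lambda>n. closure (E n))) = {}"
      using ran sub
      by (intro Baire_category_alt disjI1 completely_metrizable_space_closedin
          completely_metrizable_space_euclidean)
         (auto simp: closedin_closed_eq)
    moreover have "\<Union> (range (\<lambda>n. closure (E n))) = ran_op T"
    proof
      show "ran_op T \<subseteq> \<Union> (range (\<lambda>n. closure (E n)))"
      proof
        fix y assume "y \<in> ran_op T"
        then obtain x where "(x, y) \<in> T" by (rule ran_opE)
        moreover obtain n where "norm x \<le> real n"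
          using real_arch_simple by blast
        ultimately have "y \<in> E n" by (auto simp: E_def)
        then show "y \<in> \<Union> (range (\<lambda>n. closure (E n)))"
          using closure_subset by blast
      qed
    qed (use sub in blast)
    ultimately have "ran_op T = {}"
      using interior_of_topspace[of ?X] by simp
    then show False
      using csubspace_0[OF csubspace_ran_op[OF T]] by blast
  qed
  then obtain n y0 where "y0 \<in> ?X interior_of closure (E n)" by blast
  then obtain U where U: "openin ?X U" "y0 \<in> U" "U \<subseteq> closure (E n)"
    unfolding interior_of_def by blast
  then obtain e where "e > 0" and e: "ball y0 e \<inter> ran_op T \<subseteq> U"
    unfolding openin_contains_ball by blast
  have y0: "y0 \<in> ran_op T" "y0 \<in> closure (E n)"
    using U sub by auto
  \<comment> \<open>A small \<open>y\<close> is the difference of \<open>y0 + y\<close> and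
    \<open>y0\<close>, both in the closure of \<open>E n\<close>; subtracting approximating members
    of \<open>E n\<close> doubles the bound on the preimage.\<close>
  have approx: "\<exists>x y'. (x, y') \<in> T \<and> norm x \<le> 2 * real n \<and> norm (y - y') < d"
    if y: "y \<in> ran_op T" "norm y < e" and "d > 0" for y d
  proof -
    have "y0 + y \<in> ball y0 e"
      using y(2) by (simp add: dist_norm)
    then have "y0 + y \<in> closure (E n)"
      using e U(3) csubspace_add[OF csubspace_ran_op[OF T] y0(1) y(1)] by blast
    then obtain a where a: "a \<in> E n" "dist a (y0 + y) < d / 2"
      using \<open>d > 0\<close> unfolding closure_approachable by (meson half_gt_zero)
    obtain b where b: "b \<in> E n" "dist b y0 < d / 2"
      using \<open>d > 0\<close> y0(2) unfolding closure_approachable by (meson half_gt_zero)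
    obtain u v where uv: "(u, a) \<in> T" "norm u \<le> real n" "(v, b) \<in> T" "norm v \<le> real n"
      using a b by (auto simp: E_def)
    have "norm (y - (a - b)) = norm ((b - y0) - (a - (y0 + y)))"
      by (simp add: algebra_simps)
    also have "\<dots> < d"
      using a(2) b(2) norm_triangle_ineq4[of "b - y0" "a - (y0 + y)"] by (simp add: dist_norm)
    finally have "norm (y - (a - b)) < d" .
    moreover have "norm (u - v) \<le> 2 * real n"
      using norm_triangle_ineq4[of u v] uv by linarith
    ultimately show ?thesis
      using linop_diff[OF T uv(1,3)] by blast
  qed
  show ?thesis
  proof (rule that[of "4 * real n / e"])
    show "0 \<le> 4 * real n / e"
      using \<open>e > 0\<close> by simp
    fix y assume y: "y \<in> ran_op T"
    show "\<exists>x y'. (x, y') \<in> T \<and> norm x \<le> 4 * real n / e * norm y \<and> norm (y - y') \<le> norm y / 2"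
    proof (cases "y = 0")
      case True
      then show ?thesis using linop_0[OF T] by force
    next
      case False
      \<comment> \<open>Rescales \<open>y\<close> to norm \<open>e / 2\<close>, inside the ball.
        Scaling back turns the bound \<open>2 * real n\<close> into
        \<open>4 * real n / e * norm y\<close> and the tolerance \<open>e / 4\<close> into
        \<open>norm y / 2\<close>.\<close>
      define s where "s = e / (2 * norm y)"
      have "s > 0"
        using False \<open>e > 0\<close> by (simp add: s_def)
      have "norm (s *\<^sub>R y) < e"
        using False \<open>e > 0\<close> by (simp add: s_def)
      then obtain x y' where xy: "(x, y') \<in> T" "norm x \<le> 2 * real n" "norm (s *\<^sub>R y - y') < e / 4"
        using approx[of "s *\<^sub>R y" "e / 4"] csubspace_scaleR[OF csubspace_ran_op[OF T] y] \<open>e > 0\<close> by auto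
      have "norm ((1 / s) *\<^sub>R x) = norm x / s"
        using \<open>s > 0\<close> by simp
      also have "\<dots> \<le> 2 * real n / s"
        using xy(2) \<open>s > 0\<close> by (intro divide_right_mono) auto
      also have "\<dots> = 4 * real n / e * norm y"
        by (simp add: s_def)
      finally have 1: "norm ((1 / s) *\<^sub>R x) \<le> 4 * real n / e * norm y" .
      have "y - (1 / s) *\<^sub>R y' = (1 / s) *\<^sub>R (s *\<^sub>R y - y')"
        using \<open>s > 0\<close> by (simp add: scaleR_diff_right)
      then have "norm (y - (1 / s) *\<^sub>R y') = norm (s *\<^sub>R y - y') / s"
        using \<open>s > 0\<close> by simp
      also have "\<dots> \<le> (e / 4) / s"
        using xy(3) \<open>s > 0\<close> by (intro divide_right_mono) auto
      also have "\<dots> = norm y / 2"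
        using \<open>e > 0\<close> by (simp add: s_def)
      finally show ?thesis
        using 1 linop_scaleR[OF T xy(1), of "1 / s"] by blast
    qed
  qed
qed

text \<open>The approximate solution is applied repeatedly to the remaining error. Errors halve, so
  the corrections sum to at most 2 C times \<open>norm y\<close>, and closedness of the graph
  carries the partial sums to an exact preimage.\<close>

lemma closed_range_bounded_preimages:
  fixes T :: "'a::chilbert linop"
  assumes T: "is_linop T" "closed T" and ran: "closed (ran_op T)"
  obtains C where "C \<ge> 0" "\<And>y. y \<in> ran_op T \<Longrightarrow> \<exists>x. (x, y) \<in> T \<and> norm x \<le> C * norm y"
proof -
  obtain C where "C \<ge> 0" and
    "\<forall>y\<in>ran_op T. \<exists>x y'. (x, y') \<in> T \<and> norm x \<le> C * norm y \<and> norm (y - y') \<le> norm y / 2"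
    using closed_range_approximate_preimages[OF T(1) ran] by metis
  then obtain f g where fg: "\<And>y. y \<in> ran_op T \<Longrightarrow> (f y, g y) \<in> T"
    and f: "\<And>y. y \<in> ran_op T \<Longrightarrow> norm (f y) \<le> C * norm y"
    and g: "\<And>y. y \<in> ran_op T \<Longrightarrow> norm (y - g y) \<le> norm y / 2"
    by metis
  show ?thesis
  proof (rule that[of "2 * C"])
    show "0 \<le> 2 * C" using \<open>C \<ge> 0\<close> by simp
    fix y assume y: "y \<in> ran_op T"
    \<comment> \<open>The part of \<open>y\<close> still unsolved after \<open>n\<close>
      corrections.\<close>
    define r where "r n = ((\<lambda>z. z - g z) ^^ n) y" for n
    have r_Suc: "r (Suc n) = r n - g (r n)" for n
      by (simp add: r_def)
    have r_ran: "r n \<in> ran_op T" for n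
    proof (induction n)
      case (Suc n)
      then show ?case
        unfolding r_Suc by (intro csubspace_diff[OF csubspace_ran_op[OF T(1)]] ran_opI[OF fg])
    qed (simp add: r_def y)
    have r_norm: "norm (r n) \<le> norm y * (1/2) ^ n" for n
    proof (induction n)
      case (Suc n)
      then show ?case
        using g[OF r_ran[of n]] by (simp add: r_Suc)
    qed (simp add: r_def)
    have f_norm: "norm (f (r n)) \<le> C * norm y * (1/2) ^ n" for n
      using order_trans[OF f[OF r_ran[of n]] mult_left_mono[OF r_norm \<open>C \<ge> 0\<close>]] by (simp add: mult_ac)
    have sums: "(\<lambda>n. C * norm y * (1/2) ^ n) sums (C * norm y * 2)"
      using sums_mult[OF geometric_sums[of "1/2::real"], of "C * norm y"] by simp
    have summable: "summable (\<lambda>n. f (r n))"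
      by (rule summable_comparison_test'[OF sums_summable[OF sums]]) (rule f_norm)
    have partial: "(\<Sum>i<n. f (r i), y - r n) \<in> T" for n
    proof (induction n)
      case 0
      then show ?case using linop_0[OF T(1)] by (simp add: r_def)
    next
      case (Suc n)
      then show ?case
        using linop_add[OF T(1) Suc fg[OF r_ran[of n]]] by (simp add: r_Suc algebra_simps)
    qed
    have "(\<lambda>n. norm y * (1/2::real) ^ n) \<longlonglongrightarrow> 0"
      by (intro tendsto_mult_right_zero LIMSEQ_realpow_zero) auto
    then have "r \<longlonglongrightarrow> 0"
      by (rule Lim_null_comparison[rotated]) (simp add: r_norm)
    then have "(\<lambda>n. (\<Sum>i<n. f (r i), y - r n)) \<longlonglongrightarrow> (\<Sum>n. f (r n), y - 0)"
      by (intro tendsto_Pair summable_LIMSEQ[OF summable] tendsto_diff tendsto_const)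
    then have "(\<Sum>n. f (r n), y) \<in> T"
      using closed_sequentially[OF T(2) partial] by simp
    moreover have "norm (\<Sum>n. f (r n)) \<le> 2 * C * norm y"
      using norm_suminf_le[OF f_norm sums_summable[OF sums]] sums_unique[OF sums] by (simp add: mult_ac)
    ultimately show "\<exists>x. (x, y) \<in> T \<and> norm x \<le> 2 * C * norm y" by blast
  qed
qed

section \<open>Moore-Penrose inverses of operators with closed range\<close>

definition graph_of :: "('a \<Rightarrow> 'a) \<Rightarrow> 'a linop" where
  "graph_of f = {(x, f x) |x. True}"

lemma mem_graph_of [simp]: "(x, y) \<in> graph_of f \<longleftrightarrow> y = f x"
  by (auto simp: graph_of_def)

lemma graph_of_inject [simp]: "graph_of f = graph_of g \<longleftrightarrow> f = g"
  by (metis ext mem_graph_of)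

lemma graph_of_mult: "graph_of f \<cdot>\<^sub>o graph_of g = graph_of (\<lambda>x. f (g x))"
  by (auto simp: op_mult_def graph_of_def)

lemma mem_moore_penrose:
  "(y, x) \<in> moore_penrose A \<longleftrightarrow>
    (\<exists>y1 y2. y = y1 + y2 \<and> (x, y1) \<in> A \<and> x \<in> orth (ker_op A) \<and> y2 \<in> orth (ran_op A))"
  by (auto simp: moore_penrose_def)

lemma mem_op_mult: "(x, z) \<in> A \<cdot>\<^sub>o B \<longleftrightarrow> (\<exists>y. (x, y) \<in> B \<and> (y, z) \<in> A)"
  by (simp add: op_mult_def)

lemma ker_op_graph_of: "ker_op (graph_of K) = {x. K x = 0}"
  by (auto simp: ker_op_def)

lemma ran_op_graph_of: "ran_op (graph_of K) = range K"
  by (force simp: ran_op_def graph_of_def)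

lemma mem_moore_penrose_graph:
  "(u, y) \<in> moore_penrose (graph_of K) \<longleftrightarrow>
    (\<exists>n. u = K y + n \<and> y \<in> orth {x. K x = 0} \<and> n \<in> orth (range K))"
  by (auto simp: mem_moore_penrose ker_op_graph_of ran_op_graph_of)

text \<open>With closed range, every vector splits along the range and its complement, and
  closedness of the kernel allows its component to be removed from a preimage. Two such preimages
  differ by a vector both in the kernel and orthogonal to it.\<close>

lemma moore_penrose_eq_graph:
  fixes T :: "'a::chilbert linop"
  assumes T: "is_linop T" "closed T" "closed (ran_op T)"
  obtains K where "moore_penrose T = graph_of K"
proof -
  have "\<exists>!x. (y, x) \<in> moore_penrose T" for y
  proof (rule ex_ex1I)
    obtain y1 y2 where y: "y1 \<in> ran_op T" "y2 \<in> orth (ran_op T)" "y = y1 + y2"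
      by (rule orthogonal_projection_exists[OF csubspace_ran_op[OF T(1)] T(3), of y])
    then obtain x where x: "(x, y1) \<in> T" by (auto elim: ran_opE)
    obtain n m where nm: "n \<in> ker_op T" "m \<in> orth (ker_op T)" "x = n + m"
      by (rule orthogonal_projection_exists[OF csubspace_ker_op[OF T(1)] closed_ker_op[OF T(2)], of x])
    then have "(m, y1) \<in> T"
      using linop_diff[OF T(1) x, of n 0] by (simp add: ker_op_def)
    then show "\<exists>x. (y, x) \<in> moore_penrose T"
      using y nm mem_moore_penrose by blast
  next
    fix x x' assume "(y, x) \<in> moore_penrose T" "(y, x') \<in> moore_penrose T"
    then obtain y1 y2 z1 z2 where
      y: "y = y1 + y2" "(x, y1) \<in> T" "x \<in> orth (ker_op T)" "y2 \<in> orth (ran_op T)" and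
      z: "y = z1 + z2" "(x', z1) \<in> T" "x' \<in> orth (ker_op T)" "z2 \<in> orth (ran_op T)"
      unfolding mem_moore_penrose by blast
    have "y1 - z1 \<in> ran_op T"
      using linop_diff[OF T(1) y(2) z(2)] by (rule ran_opI)
    moreover have "y1 - z1 = z2 - y2"
      using y(1) z(1) by (simp add: algebra_simps)
    then have "y1 - z1 \<in> orth (ran_op T)"
      using csubspace_diff[OF csubspace_orth z(4) y(4)] by simp
    ultimately have "y1 - z1 = 0"
      by (rule orth_disjoint)
    then have "x - x' \<in> ker_op T"
      using linop_diff[OF T(1) y(2) z(2)] by (simp add: ker_op_def)
    then have "x - x' = 0"
      using csubspace_diff[OF csubspace_orth y(3) z(3)] by (rule orth_disjoint)
    then show "x = x'" by simp
  qed
  then have "moore_penrose T = graph_of (\<lambda>y. THE x. (y, x) \<in> moore_penrose T)"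
    by (auto simp: the1_equality) (metis theI')
  then show ?thesis by (rule that)
qed

text \<open>The kernel of K is the complement of the range of T, and the complement of the range of
  K is the kernel of T. The second fact rests on density: the domain of T is contained in the sum of
  its kernel and the range of K.\<close>

lemma moore_penrose_graph_eq:
  fixes T :: "'a::chilbert linop"
  assumes T: "is_linop T" "closed T" "densely_defined T" and K: "moore_penrose T = graph_of K"
  shows "moore_penrose (graph_of K) = T"
proof -
  have KI: "K (y1 + y2) = x" if "(x, y1) \<in> T" "x \<in> orth (ker_op T)" "y2 \<in> orth (ran_op T)" for x y1 y2
    using that mem_moore_penrose[of "y1 + y2" x T] K by (metis mem_graph_of)
  have KE: "\<exists>y1 y2. y = y1 + y2 \<and> (K y, y1) \<in> T \<and> K y \<in> orth (ker_op T) \<and> y2 \<in> orth (ran_op T)" for y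
    using mem_moore_penrose[of y "K y" T] K by simp
  have K0: "K z = 0" if "z \<in> orth (ran_op T)" for z
    using KI[of 0 0 z] linop_0[OF T(1)] that by simp
  have split: "\<exists>n. n \<in> ker_op T \<and> x = n + K y" if xy: "(x, y) \<in> T" for x y
  proof -
    obtain n m where nm: "n \<in> ker_op T" "m \<in> orth (ker_op T)" "x = n + m"
      by (rule orthogonal_projection_exists[OF csubspace_ker_op[OF T(1)] closed_ker_op[OF T(2)], of x])
    then have "(m, y) \<in> T"
      using linop_diff[OF T(1) xy, of n 0] by (simp add: ker_op_def)
    then have "K y = m"
      using KI[of m y 0] nm by simp
    then show ?thesis using nm by blast
  qed
  have "(u, y) \<in> T" if uy: "(u, y) \<in> moore_penrose (graph_of K)" for u y
  proof -
    obtain n where n: "u = K y + n" "y \<in> orth {x. K x = 0}" "n \<in> orth (range K)"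
      using uy unfolding mem_moore_penrose_graph by blast
    obtain y1 y2 where y: "y = y1 + y2" "(K y, y1) \<in> T" "y2 \<in> orth (ran_op T)"
      using KE by blast
    \<comment> \<open>\<open>y2\<close> lies in the kernel of \<open>K\<close>, to which
      \<open>y\<close> is orthogonal; so the component of \<open>y\<close> outside the range of
      \<open>T\<close> vanishes.\<close>
    have "cinner y2 y = 0"
      using K0[OF y(3)] n(2) by (simp add: orthD)
    then have "cinner y2 y2 = 0"
      using orthD2[OF y(3) ran_opI[OF y(2)]] by (simp add: y(1) cinner_add_right)
    then have Ky: "(K y, y) \<in> T"
      using y by simp
    obtain a b where ab: "a \<in> ker_op T" "b \<in> orth (ker_op T)" "n = a + b"
      by (rule orthogonal_projection_exists[OF csubspace_ker_op[OF T(1)] closed_ker_op[OF T(2)], of n])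
    \<comment> \<open>The component of \<open>n\<close> orthogonal to the kernel is orthogonal to
      both summands containing the domain, so density forces it to be 0.\<close>
    have "b \<in> orth (dom_op T)"
    proof (rule orthI)
      fix x assume "x \<in> dom_op T"
      then obtain z where "(x, z) \<in> T" by (auto simp: dom_op_def)
      then obtain k where k: "k \<in> ker_op T" "x = k + K z" using split by blast
      have "cinner (K z) n = 0" using n(3) by (simp add: orthD)
      moreover have "cinner (K z) a = 0" using KE[of z] ab(1) by (auto dest: orthD2)
      ultimately show "cinner x b = 0"
        using orthD[OF ab(2) k(1)] by (simp add: k(2) ab(3) cinner_add_left cinner_add_right)
    qed
    then have "b = 0"
      using T(3) dense_iff_orth_trivial[OF csubspace_dom_op[OF T(1)]] by (auto simp: densely_defined_def)
    then have "(n, 0) \<in> T"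
      using ab by (simp add: ker_op_def)
    then show ?thesis
      using linop_add[OF T(1) Ky] n(1) by fastforce
  qed
  moreover have "(x, y) \<in> moore_penrose (graph_of K)" if xy: "(x, y) \<in> T" for x y
  proof -
    obtain n where n: "n \<in> ker_op T" "x = n + K y" using split[OF xy] by blast
    have "y \<in> orth {x. K x = 0}"
    proof (rule orthI)
      fix z assume "z \<in> {x. K x = 0}"
      then obtain z1 z2 where z: "z = z1 + z2" "(0, z1) \<in> T" "z2 \<in> orth (ran_op T)"
        using KE[of z] by auto
      then show "cinner z y = 0"
        using linop_zero_unique[OF T(1) z(2)] orthD2[OF z(3) ran_opI[OF xy]] by simp
    qed
    moreover have "n \<in> orth (range K)"
      using KE n(1) by (blast intro: orthI dest: orthD2)
    ultimately show ?thesis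
      unfolding mem_moore_penrose_graph using n(2) by (auto simp: add.commute)
  qed
  ultimately show ?thesis by auto
qed

subsection \<open>Moore--Penrose inverses of bounded operators\<close>

text \<open>\<open>K y\<close> is the shortest preimage of the range component of \<open>y\<close>:
  any other preimage differs from it by an orthogonal kernel vector. Hence it inherits the bound
  that holds for some preimage.\<close>

lemma closed_range_bounded_moore_penrose:
  fixes T :: "'a::chilbert linop"
  assumes T: "is_linop T" "closed T" "closed (ran_op T)" and K: "moore_penrose T = graph_of K"
  shows "bounded_linear K" "K (scaleC c x) = scaleC c (K x)"
proof -
  have KI: "K (y1 + y2) = x" if "(x, y1) \<in> T" "x \<in> orth (ker_op T)" "y2 \<in> orth (ran_op T)" for x y1 y2
    using that mem_moore_penrose[of "y1 + y2" x T] K by (metis mem_graph_of)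
  have KE: "\<exists>y1 y2. y = y1 + y2 \<and> (K y, y1) \<in> T \<and> K y \<in> orth (ker_op T) \<and> y2 \<in> orth (ran_op T)" for y
    using mem_moore_penrose[of y "K y" T] K by simp
  have add: "K (x + y) = K x + K y" for x y
  proof -
    obtain x1 x2 where x: "x = x1 + x2" "(K x, x1) \<in> T" "K x \<in> orth (ker_op T)" "x2 \<in> orth (ran_op T)"
      using KE by blast
    obtain y1 y2 where y: "y = y1 + y2" "(K y, y1) \<in> T" "K y \<in> orth (ker_op T)" "y2 \<in> orth (ran_op T)"
      using KE by blast
    have "K ((x1 + y1) + (x2 + y2)) = K x + K y"
      by (intro KI linop_add csubspace_add csubspace_orth T x y)
    then show ?thesis
      by (metis x(1) y(1) add.assoc add.left_commute)
  qed
  show scale: "K (scaleC c x) = scaleC c (K x)" for c x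
  proof -
    obtain x1 x2 where x: "x = x1 + x2" "(K x, x1) \<in> T" "K x \<in> orth (ker_op T)" "x2 \<in> orth (ran_op T)"
      using KE by blast
    have "K (scaleC c x1 + scaleC c x2) = scaleC c (K x)"
      by (intro KI linop_scaleC csubspace_scaleC csubspace_orth T x)
    then show ?thesis
      by (metis x(1) scaleC_add_right)
  qed
  obtain C where "C \<ge> 0" and C: "\<And>y. y \<in> ran_op T \<Longrightarrow> \<exists>x. (x, y) \<in> T \<and> norm x \<le> C * norm y"
    using closed_range_bounded_preimages[OF T] by metis
  have bound: "norm (K y) \<le> norm y * C" for y
  proof -
    obtain y1 y2 where y: "y = y1 + y2" "(K y, y1) \<in> T" "K y \<in> orth (ker_op T)" "y2 \<in> orth (ran_op T)"
      using KE by blast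
    obtain x where x: "(x, y1) \<in> T" "norm x \<le> C * norm y1"
      using C[OF ran_opI[OF y(2)]] by blast
    have "(x - K y, 0) \<in> T"
      using linop_diff[OF T(1) x(1) y(2)] by simp
    then have "cinner (K y) (x - K y) = 0"
      using orthD2[OF y(3)] by (simp add: ker_op_def)
    then have "(norm (K y))\<^sup>2 \<le> (norm x)\<^sup>2"
      using power2_norm_add[of "K y" "x - K y"] by simp
    then have "norm (K y) \<le> norm x"
      by (rule power2_le_imp_le) simp
    moreover have "norm y1 \<le> norm y"
    proof (rule power2_le_imp_le)
      show "(norm y1)\<^sup>2 \<le> (norm y)\<^sup>2"
        using power2_norm_add[of y1 y2] orthD[OF y(4) ran_opI[OF y(2)]] by (simp add: y(1))
    qed simp
    then have "C * norm y1 \<le> C * norm y"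
      using \<open>C \<ge> 0\<close> by (rule mult_left_mono)
    ultimately show ?thesis
      using x(2) by (simp add: mult.commute)
  qed
  show "bounded_linear K"
  proof (rule bounded_linear_intro[OF add _ bound])
    show "K (r *\<^sub>R x) = r *\<^sub>R K x" for r x
      by (metis scale scaleC_of_real)
  qed
qed

lemma adj_graph_of:
  assumes "adjoint_pair K W" shows "adj (graph_of K) = graph_of W"
proof -
  have "(y, z) \<in> adj (graph_of K) \<longleftrightarrow> z = W y" for y z
    using cinner_ext[of z "W y"] adjoint_pairD[OF assms] by (auto simp: adj_def)
  then show ?thesis by auto
qed

lemma adjoint_pair_kernel_decomposition:
  assumes "adjoint_pair K W"
  obtains m n where "K m = 0" "n \<in> orth {x. K x = 0}" "x = m + n"
proof -
  have "csubspace {x. K x = 0}" "closed {x. K x = 0}"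
    unfolding adjoint_pair_kernel[OF assms] by (rule csubspace_orth closed_orth)+
  then show ?thesis
    using orthogonal_projection_exists[of "{x. K x = 0}" x] that by blast
qed

lemma range_subset_orth_kernel:
  assumes "adjoint_pair K W" shows "W y \<in> orth {x. K x = 0}"
  unfolding adjoint_pair_kernel[OF assms] by (rule range_in_orth_orth)

lemma ker_op_moore_penrose_graph:
  assumes "adjoint_pair K W" shows "ker_op (moore_penrose (graph_of K)) = orth (range K)"
  by (auto simp: ker_op_def mem_moore_penrose_graph adjoint_pair_zero[OF assms])

lemma ran_op_moore_penrose_graph: "ran_op (moore_penrose (graph_of K)) = orth {x. K x = 0}"
proof (intro set_eqI iffI)
  fix y assume "y \<in> orth {x. K x = 0}"
  then have "(K y + 0, y) \<in> moore_penrose (graph_of K)"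
    unfolding mem_moore_penrose_graph using zero_in_orth by blast
  then show "y \<in> ran_op (moore_penrose (graph_of K))" by (rule ran_opI)
qed (auto elim!: ran_opE simp: mem_moore_penrose_graph)

text \<open>The inner inverse has kernel \<open>orth (range K)\<close> and range
  \<open>orth {x. K x = 0}\<close>. Demanding values orthogonal to that kernel removes the ambiguity
  \<open>n\<close>, and the part of \<open>y\<close> orthogonal to that range lies in the kernel of
  \<open>K\<close>.\<close>

lemma moore_penrose_moore_penrose_graph:
  assumes "adjoint_pair K W"
  shows "moore_penrose (moore_penrose (graph_of K)) = graph_of K"
proof -
  have "(y, x) \<in> moore_penrose (moore_penrose (graph_of K)) \<longleftrightarrow> x = K y" for x y
  proof
    assume "(y, x) \<in> moore_penrose (moore_penrose (graph_of K))"
    then obtain y1 y2 n where y: "y = y1 + y2" "y2 \<in> orth (orth {x. K x = 0})"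
      and x: "x \<in> orth (orth (range K))" "x = K y1 + n" "n \<in> orth (range K)"
      unfolding mem_moore_penrose[of y] mem_moore_penrose_graph
        ker_op_moore_penrose_graph[OF assms] ran_op_moore_penrose_graph by blast
    have "K y2 = 0"
    proof -
      have "y2 \<in> {x. K x = 0}"
        using y(2) by (simp add: adjoint_pair_kernel[OF assms] del: mem_Collect_eq)
      then show ?thesis by simp
    qed
    moreover have "n = 0"
    proof (rule orth_disjoint[OF x(3)])
      show "n \<in> orth (orth (range K))"
        using csubspace_diff[OF csubspace_orth x(1) range_in_orth_orth[of K y1]] by (simp add: x(2))
    qed
    ultimately show "x = K y"
      using x(2) by (simp add: y(1) adjoint_pair_add[OF assms])
  next
    assume x: "x = K y"
    obtain m n where mn: "K m = 0" "n \<in> orth {x. K x = 0}" "y = m + n"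
      by (rule adjoint_pair_kernel_decomposition[OF assms])
    have "m \<in> orth (orth {x. K x = 0})"
      using mn(1) by (auto intro: subsetD[OF subset_orth_orth])
    moreover have "(x, n) \<in> moore_penrose (graph_of K)"
      unfolding mem_moore_penrose_graph
      by (rule exI[of _ 0]) (simp add: x mn adjoint_pair_add[OF assms])
    moreover have "x \<in> orth (orth (range K))"
      unfolding x by (rule range_in_orth_orth)
    ultimately show "(y, x) \<in> moore_penrose (moore_penrose (graph_of K))"
      unfolding mem_moore_penrose[of y]
        ker_op_moore_penrose_graph[OF assms] ran_op_moore_penrose_graph
      using mn(3) add.commute by blast
  qed
  then show ?thesis by auto
qed

text \<open>Reduces equality of unbounded operators, domains included, to equality of
  functions.\<close>

lemma moore_penrose_graph_inject:
  assumes "adjoint_pair K W" "adjoint_pair L V"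
  shows "moore_penrose (graph_of K) = moore_penrose (graph_of L) \<longleftrightarrow> K = L"
  using moore_penrose_moore_penrose_graph[OF assms(1)] moore_penrose_moore_penrose_graph[OF assms(2)]
  by (metis graph_of_inject)

text \<open>The domain consists of the vectors K y + n, and the adjoint identity can be tested on
  the two summands separately: y = 0 says that v is orthogonal to the kernel of W, and n = 0 says
  that u - W v is orthogonal to the range of W.\<close>

lemma adj_moore_penrose_graph:
  assumes "adjoint_pair K W"
  shows "adj (moore_penrose (graph_of K)) = moore_penrose (graph_of W)"
proof -
  note WK = adjoint_pair_sym[OF assms]
  have "(u, v) \<in> moore_penrose (graph_of W)" if uv: "(u, v) \<in> adj (moore_penrose (graph_of K))" for u v
  proof -
    have *: "cinner y u = cinner (K y + n) v" if "y \<in> orth {x. K x = 0}" "n \<in> orth (range K)" for y n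
      using uv that unfolding adj_def by (auto simp: mem_moore_penrose_graph)
    have "v \<in> orth {x. W x = 0}"
      unfolding adjoint_pair_kernel[OF WK]
      using *[of 0] by (auto intro!: orthI simp: adjoint_pair_zero[OF assms])
    moreover have "u - W v \<in> orth (orth {x. K x = 0})"
      using *[of _ 0] by (auto intro!: orthI simp: cinner_diff_right adjoint_pairD[OF assms])
    then have "u - W v \<in> orth (range W)"
      unfolding adjoint_pair_kernel[OF assms] by simp
    ultimately show ?thesis
      unfolding mem_moore_penrose_graph by (auto intro!: exI[of _ "u - W v"])
  qed
  moreover have "(u, v) \<in> adj (moore_penrose (graph_of K))" if uv: "(u, v) \<in> moore_penrose (graph_of W)" for u v
  proof -
    obtain n where n: "u = W v + n" "v \<in> orth {x. W x = 0}" "n \<in> orth (range W)"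
      using uv unfolding mem_moore_penrose_graph by blast
    have "cinner y u = cinner (K y + m) v" if y: "y \<in> orth {x. K x = 0}" and m: "m \<in> orth (range K)" for y m
    proof -
      have "cinner y n = 0"
        using y n(3) unfolding adjoint_pair_kernel[OF assms, symmetric] by (rule orthD2)
      moreover have "cinner m v = 0"
        using n(2) m unfolding adjoint_pair_kernel[OF WK, symmetric] by (rule orthD)
      ultimately show ?thesis
        by (simp add: n(1) cinner_add_right cinner_add_left adjoint_pairD[OF assms])
    qed
    then show ?thesis
      unfolding adj_def by (auto simp: mem_moore_penrose_graph)
  qed
  ultimately show ?thesis by auto
qed

text \<open>The reverse order law fails in general. Under the kernel condition, B A has the kernel
  of A, its range has the complement of the range of B, and the ambiguity left by inverting A is
  annihilated by B.\<close>

lemma moore_penrose_graph_mult: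
  assumes A: "adjoint_pair A A'" and B: "adjoint_pair B B'" and ker: "{x. B x = 0} = orth (range A)"
  shows "moore_penrose (graph_of A) \<cdot>\<^sub>o moore_penrose (graph_of B) = moore_penrose (graph_of (\<lambda>x. B (A x)))"
proof -
  have AB: "adjoint_pair (\<lambda>x. B (A x)) (\<lambda>x. A' (B' x))"
    by (rule adjoint_pair_comp[OF B A])
  have kerBA: "{x. B (A x) = 0} = {x. A x = 0}"
  proof (intro set_eqI iffI)
    fix x assume "x \<in> {x. B (A x) = 0}"
    then have "A x \<in> orth (range A)"
      using ker by blast
    then show "x \<in> {x. A x = 0}"
      using orth_disjoint[of "A x" "range A"] by simp
  qed (simp add: adjoint_pair_zero[OF B])
  have kerB: "orth (range B) = {x. B' x = 0}"
    and kerAB: "orth (range (\<lambda>x. B (A x))) = {x. A' (B' x) = 0}"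
    by (simp_all add: adjoint_pair_kernel[OF adjoint_pair_sym[OF B]]
        adjoint_pair_kernel[OF adjoint_pair_sym[OF AB]])
  have ranBA: "orth (range (\<lambda>x. B (A x))) = orth (range B)"
    unfolding kerB kerAB
  proof (intro set_eqI iffI)
    fix v assume "v \<in> {x. A' (B' x) = 0}"
    \<comment> \<open>\<open>B' v\<close> is orthogonal to the range of \<open>A\<close>, hence in
      the kernel of \<open>B\<close>; as a value of \<open>B'\<close> it is also orthogonal to that
      kernel.\<close>
    then have "B' v \<in> {x. B x = 0}"
      unfolding ker adjoint_pair_kernel[OF adjoint_pair_sym[OF A], symmetric] by simp
    then show "v \<in> {x. B' x = 0}"
      using orth_disjoint[OF _ range_subset_orth_kernel[OF B, of v]] by simp
  qed (simp add: adjoint_pair_zero[OF adjoint_pair_sym[OF A]])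
  have "(x, z) \<in> moore_penrose (graph_of A) \<cdot>\<^sub>o moore_penrose (graph_of B) \<longleftrightarrow>
      (x, z) \<in> moore_penrose (graph_of (\<lambda>x. B (A x)))" for x z
  proof
    assume "(x, z) \<in> moore_penrose (graph_of A) \<cdot>\<^sub>o moore_penrose (graph_of B)"
    then obtain y n m where y: "x = B y + n" "y \<in> orth {x. B x = 0}" "n \<in> orth (range B)"
      and z: "y = A z + m" "z \<in> orth {x. A x = 0}" "m \<in> orth (range A)"
      unfolding mem_op_mult mem_moore_penrose_graph by blast
    have "B m = 0"
      using z(3) ker by blast
    then show "(x, z) \<in> moore_penrose (graph_of (\<lambda>x. B (A x)))"
      unfolding mem_moore_penrose_graph kerBA ranBA
      using y z by (auto simp: adjoint_pair_add[OF B])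
  next
    assume "(x, z) \<in> moore_penrose (graph_of (\<lambda>x. B (A x)))"
    then obtain n where n: "x = B (A z) + n" "z \<in> orth {x. A x = 0}" "n \<in> orth (range B)"
      unfolding mem_moore_penrose_graph kerBA ranBA by blast
    have "A z \<in> orth {x. B x = 0}"
      unfolding ker by (rule range_in_orth_orth)
    then have "(x, A z) \<in> moore_penrose (graph_of B)"
      unfolding mem_moore_penrose_graph using n by blast
    moreover have "(A z, z) \<in> moore_penrose (graph_of A)"
      unfolding mem_moore_penrose_graph using n(2) by (intro exI[of _ 0]) simp
    ultimately show "(x, z) \<in> moore_penrose (graph_of A) \<cdot>\<^sub>o moore_penrose (graph_of B)"
      unfolding mem_op_mult by blast
  qed
  then show ?thesis by auto
qed

lemma is_linop_graph_of:
  assumes "adjoint_pair K W" shows "is_linop (graph_of K)"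
  by (simp add: is_linop_def adjoint_pair_zero[OF assms] adjoint_pair_add[OF assms]
      adjoint_pair_scaleC[OF assms])

lemma is_linop_moore_penrose_graph:
  assumes "adjoint_pair K W" shows "is_linop (moore_penrose (graph_of K))"
  unfolding is_linop_def
proof (intro conjI allI impI)
  show "(0, 0) \<in> moore_penrose (graph_of K)"
    by (simp add: mem_moore_penrose_graph adjoint_pair_zero[OF assms])
next
  fix x y u v assume "(x, y) \<in> moore_penrose (graph_of K)" "(u, v) \<in> moore_penrose (graph_of K)"
  then obtain n m where n: "x = K y + n" "y \<in> orth {x. K x = 0}" "n \<in> orth (range K)"
    and m: "u = K v + m" "v \<in> orth {x. K x = 0}" "m \<in> orth (range K)"
    unfolding mem_moore_penrose_graph by blast
  have "x + u = K (y + v) + (n + m)"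
    by (simp add: n m adjoint_pair_add[OF assms])
  then show "(x + u, y + v) \<in> moore_penrose (graph_of K)"
    unfolding mem_moore_penrose_graph using csubspace_add[OF csubspace_orth] n m by blast
next
  fix c x y assume "(x, y) \<in> moore_penrose (graph_of K)"
  then obtain n where n: "x = K y + n" "y \<in> orth {x. K x = 0}" "n \<in> orth (range K)"
    unfolding mem_moore_penrose_graph by blast
  have "scaleC c x = K (scaleC c y) + scaleC c n"
    by (simp add: n scaleC_add_right adjoint_pair_scaleC[OF assms])
  then show "(scaleC c x, scaleC c y) \<in> moore_penrose (graph_of K)"
    unfolding mem_moore_penrose_graph using csubspace_scaleC[OF csubspace_orth] n by blast
next
  fix y assume "(0, y) \<in> moore_penrose (graph_of K)"
  then obtain n where n: "0 = K y + n" "y \<in> orth {x. K x = 0}" "n \<in> orth (range K)"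
    unfolding mem_moore_penrose_graph by blast
  have "cinner (K y) n = 0"
    using n(3) by (simp add: orthD)
  moreover have "n = - K y"
    using n(1) by (simp add: eq_neg_iff_add_eq_0 add.commute)
  ultimately have "K y = 0"
    by (simp add: cinner_minus_right)
  then show "y = 0"
    using orth_disjoint[OF _ n(2)] by simp
qed

text \<open>The domain is the range of K plus its complement, and only 0 is orthogonal to
  both.\<close>

lemma densely_defined_moore_penrose_graph:
  assumes "adjoint_pair K W" shows "densely_defined (moore_penrose (graph_of K))"
proof -
  let ?D = "dom_op (moore_penrose (graph_of K))"
  have D: "K y + n \<in> ?D" if "y \<in> orth {x. K x = 0}" "n \<in> orth (range K)" for y n
  proof -
    have "(K y + n, y) \<in> moore_penrose (graph_of K)"
      unfolding mem_moore_penrose_graph using that by blast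
    then show ?thesis
      by (force simp: dom_op_def)
  qed
  have "v = 0" if v: "v \<in> orth ?D" for v
  proof -
    have 1: "v \<in> orth (orth (range K))"
      using orthD[OF v D[of 0]] by (auto intro!: orthI simp: adjoint_pair_zero[OF assms])
    have "v \<in> orth (range K)"
    proof (rule orthI, clarify)
      fix y
      obtain m n where mn: "K m = 0" "n \<in> orth {x. K x = 0}" "y = m + n"
        by (rule adjoint_pair_kernel_decomposition[OF assms])
      then show "cinner (K y) v = 0"
        using orthD[OF v D[of n 0]] by (simp add: adjoint_pair_add[OF assms])
    qed
    then show ?thesis
      using 1 orth_disjoint by blast
  qed
  then have "orth ?D = {0}"
    by auto
  then show ?thesis
    unfolding densely_defined_def
    using dense_iff_orth_trivial[OF csubspace_dom_op[OF is_linop_moore_penrose_graph[OF assms]]] by simp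
qed

section \<open>Positive self-adjoint operators and their square roots\<close>

lemma positive_selfadjoint_graph_of:
  assumes "adjoint_pair R R" "\<And>x. 0 \<le> Re (cinner (R x) x)"
  shows "positive_selfadjoint (graph_of R)"
proof -
  have "dom_op (graph_of R) = UNIV"
    by (force simp: dom_op_def graph_of_def)
  then show ?thesis
    unfolding positive_selfadjoint_def densely_defined_def
    using assms by (auto simp: is_linop_graph_of[OF assms(1)] adj_graph_of[OF assms(1)] Re_cinner_commute)
qed

lemma positive_selfadjoint_moore_penrose_graph:
  assumes "adjoint_pair R R" "\<And>x. 0 \<le> Re (cinner (R x) x)"
  shows "positive_selfadjoint (moore_penrose (graph_of R))"
  unfolding positive_selfadjoint_def
proof (intro conjI allI impI)
  fix x y assume "(x, y) \<in> moore_penrose (graph_of R)"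
  then obtain n where n: "x = R y + n" "y \<in> orth {x. R x = 0}" "n \<in> orth (range R)"
    unfolding mem_moore_penrose_graph by blast
  have "cinner n y = 0"
    using n(2,3) unfolding adjoint_pair_kernel[OF assms(1), symmetric] by (rule orthD)
  then show "0 \<le> Re (cinner x y)"
    using assms(2)[of y] by (simp add: n(1) cinner_add_left)
qed (rule is_linop_moore_penrose_graph[OF assms(1)] densely_defined_moore_penrose_graph[OF assms(1)]
      adj_moore_penrose_graph[OF assms(1)])+

lemma closed_adj: "closed (adj (A :: 'a::chilbert linop))"
  unfolding closed_sequential_limits
proof (intro allI impI, elim conjE)
  fix f and l :: "'a \<times> 'a" assume f: "\<forall>n. f n \<in> adj A" and l: "f \<longlonglongrightarrow> l"
  have "cinner w (fst l) = cinner x (snd l)" if "(x, w) \<in> A" for x w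
  proof (rule LIMSEQ_unique)
    show "(\<lambda>n. cinner w (fst (f n))) \<longlonglongrightarrow> cinner w (fst l)"
      by (intro tendsto_cinner tendsto_const tendsto_fst l)
    have "cinner w (fst (f n)) = cinner x (snd (f n))" for n
      using f that unfolding adj_def by (metis (mono_tags, lifting) case_prodD mem_Collect_eq prod.collapse)
    then show "(\<lambda>n. cinner w (fst (f n))) \<longlonglongrightarrow> cinner x (snd l)"
      by (simp add: tendsto_cinner tendsto_const tendsto_snd l)
  qed
  then show "l \<in> adj A"
    unfolding adj_def by (cases l) auto
qed

lemma positive_selfadjointD:
  assumes "positive_selfadjoint P"
  shows "is_linop P" "densely_defined P" "closed P"
    "(x, y) \<in> P \<Longrightarrow> (u, v) \<in> P \<Longrightarrow> cinner y u = cinner x v"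
    "(x, y) \<in> P \<Longrightarrow> 0 \<le> Re (cinner x y)"
    "orth (ran_op P) = ker_op P"
proof -
  have P: "adj P = P"
    using assms by (simp add: positive_selfadjoint_def)
  show "is_linop P" "densely_defined P" "(x, y) \<in> P \<Longrightarrow> 0 \<le> Re (cinner x y)"
    using assms by (auto simp: positive_selfadjoint_def)
  show "closed P"
    using closed_adj[of P] P by simp
  show "cinner y u = cinner x v" if "(x, y) \<in> P" "(u, v) \<in> P"
    using that P unfolding adj_def by blast
  have "z \<in> orth (ran_op P) \<longleftrightarrow> (z, 0) \<in> adj P" for z
    by (auto simp: adj_def orth_def ran_op_def)
  then show "orth (ran_op P) = ker_op P"
    by (auto simp: ker_op_def P)
qed

text \<open>A square defined everywhere forces \<open>S\<close> to be defined everywhere, so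
  competitors for \<open>op_abs\<close> of the Cauchy dual are again functions.\<close>

lemma bounded_positive_selfadjoint_sqrt:
  assumes S: "positive_selfadjoint S" and sq: "S \<cdot>\<^sub>o S = graph_of G"
  obtains Q where "S = graph_of Q" "adjoint_pair Q Q" "\<And>x. 0 \<le> Re (cinner (Q x) x)" "\<And>x. Q (Q x) = G x"
proof -
  note S' = positive_selfadjointD[OF S]
  have "\<exists>y. (x, y) \<in> S" for x
    using sq mem_op_mult[of x "G x" S S] by auto
  then obtain Q where Q: "\<And>x. (x, Q x) \<in> S" by metis
  have "y = Q x" if "(x, y) \<in> S" for x y
    using linop_diff[OF S'(1) that Q[of x]] linop_zero_unique[OF S'(1)] by fastforce
  then have S_eq: "S = graph_of Q"
    using Q by auto
  show ?thesis
  proof (rule that[OF S_eq])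
    show "adjoint_pair Q Q"
      using S'(4)[OF Q Q] by (simp add: adjoint_pair_def)
    show "0 \<le> Re (cinner (Q x) x)" for x
      using S'(5)[OF Q[of x]] by (simp add: Re_cinner_commute)
    show "Q (Q x) = G x" for x
      using sq unfolding S_eq graph_of_mult graph_of_inject by metis
  qed
qed

text \<open>Brings unbounded competitors for \<open>op_abs T\<close> back to bounded ones. The range
  of P contains that of P P, which is the full complement of the kernel of P P; this makes the range
  of P closed, so P is the inverse of some Q, and the product law with injectivity gives Q Q =
  G.\<close>

lemma moore_penrose_positive_selfadjoint_sqrt:
  assumes P: "positive_selfadjoint P" and G: "adjoint_pair G G"
    and sq: "P \<cdot>\<^sub>o P = moore_penrose (graph_of G)"
  obtains Q where "P = moore_penrose (graph_of Q)" "adjoint_pair Q Q"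
    "\<And>x. 0 \<le> Re (cinner (Q x) x)" "\<And>x. Q (Q x) = G x"
proof -
  note P' = positive_selfadjointD[OF P]
  \<comment> \<open>By symmetry \<open>cinner y y = cinner x 0\<close> when \<open>P\<close> sends
    \<open>x\<close> to \<open>y\<close> and \<open>y\<close> to 0.\<close>
  have kerPP: "ker_op (P \<cdot>\<^sub>o P) \<subseteq> ker_op P"
  proof
    fix x assume "x \<in> ker_op (P \<cdot>\<^sub>o P)"
    then obtain y where y: "(x, y) \<in> P" "(y, 0) \<in> P"
      by (auto simp: ker_op_def mem_op_mult)
    then show "x \<in> ker_op P"
      using P'(4)[OF y] by (simp add: ker_op_def)
  qed
  have "orth (ker_op P) \<subseteq> orth (ker_op (P \<cdot>\<^sub>o P))"
    using kerPP by (rule orth_antimono)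
  also have "\<dots> = ran_op (P \<cdot>\<^sub>o P)"
    unfolding sq ker_op_moore_penrose_graph[OF G] ran_op_moore_penrose_graph adjoint_pair_kernel[OF G] ..
  also have "\<dots> \<subseteq> ran_op P"
    by (auto elim!: ran_opE simp: mem_op_mult intro: ran_opI)
  finally have "ran_op P = orth (ker_op P)"
    using subset_orth_orth[of "ran_op P"] P'(6) by auto
  then have "closed (ran_op P)"
    by (simp add: closed_orth)
  then obtain Q where Q: "moore_penrose P = graph_of Q"
    by (rule moore_penrose_eq_graph[OF P'(1,3)])
  have P_eq: "P = moore_penrose (graph_of Q)"
    using moore_penrose_graph_eq[OF P'(1,3,2) Q] by simp
  have QE: "\<exists>y1 y2. y = y1 + y2 \<and> (Q y, y1) \<in> P \<and> Q y \<in> orth (ker_op P) \<and> y2 \<in> ker_op P" for y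
    using mem_moore_penrose[of y "Q y" P] Q P'(6) by simp
  have Qadj: "adjoint_pair Q Q"
    unfolding adjoint_pair_def
  proof (intro allI)
    fix y z
    obtain y1 y2 where y: "y = y1 + y2" "(Q y, y1) \<in> P" "Q y \<in> orth (ker_op P)" "y2 \<in> ker_op P"
      using QE by blast
    obtain z1 z2 where z: "z = z1 + z2" "(Q z, z1) \<in> P" "Q z \<in> orth (ker_op P)" "z2 \<in> ker_op P"
      using QE by blast
    have "cinner (Q y) z = cinner (Q y) z1"
      using orthD2[OF y(3) z(4)] by (subst z(1)) (simp add: cinner_add_right)
    moreover have "cinner y (Q z) = cinner y1 (Q z)"
      using orthD[OF z(3) y(4)] by (subst y(1)) (simp add: cinner_add_left)
    ultimately show "cinner (Q y) z = cinner y (Q z)"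
      using P'(4)[OF y(2) z(2)] by simp
  qed
  show ?thesis
  proof (rule that[OF P_eq Qadj])
    show "0 \<le> Re (cinner (Q x) x)" for x
    proof -
      obtain y1 y2 where y: "x = y1 + y2" "(Q x, y1) \<in> P" "Q x \<in> orth (ker_op P)" "y2 \<in> ker_op P"
        using QE by blast
      have "cinner (Q x) x = cinner (Q x) y1"
        using orthD2[OF y(3,4)] by (subst (2) y(1)) (simp add: cinner_add_right)
      then show ?thesis
        using P'(5)[OF y(2)] by simp
    qed
    have "moore_penrose (graph_of (\<lambda>x. Q (Q x))) = moore_penrose (graph_of G)"
      using moore_penrose_graph_mult[OF Qadj Qadj adjoint_pair_kernel[OF Qadj]] sq P_eq by simp
    then have "(\<lambda>x. Q (Q x)) = G"
      by (simp add: moore_penrose_graph_inject[OF adjoint_pair_comp[OF Qadj Qadj] G])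
    then show "Q (Q x) = G x" for x by metis
  qed
qed

theorem theorem2p15:
  fixes T :: "'a::chilbert linop"
  assumes "is_linop T" and "densely_defined T" and "closed_op T"
    and "closed (ran_op T)"
  shows "op_abs T \<cdot>\<^sub>o adj T = T \<cdot>\<^sub>o op_abs T \<longleftrightarrow>
         op_abs (cauchy_dual T) \<cdot>\<^sub>o adj (cauchy_dual T) = cauchy_dual T \<cdot>\<^sub>o op_abs (cauchy_dual T)"
proof -
  have "closed T"
    using assms(3) by (simp add: closed_op_def)
  obtain K where K: "moore_penrose T = graph_of K"
    by (rule moore_penrose_eq_graph[OF assms(1) \<open>closed T\<close> assms(4)])
  have T_eq: "T = moore_penrose (graph_of K)"
    using moore_penrose_graph_eq[OF assms(1) \<open>closed T\<close> assms(2) K] by simp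
  note Kbd = closed_range_bounded_moore_penrose[OF assms(1) \<open>closed T\<close> assms(4) K]
  obtain W where KW: "adjoint_pair K W"
    by (rule bounded_has_adjoint[OF Kbd])
  note WK = adjoint_pair_sym[OF KW]
  define G where "G x = K (W x)" for x
  have G: "adjoint_pair G G"
    unfolding G_def by (rule adjoint_pair_comp[OF KW WK])
  obtain c where "c > 0" and c: "\<And>x. norm (K x) \<le> norm x * c"
    using bounded_linear.pos_bounded[OF Kbd(1)] by blast
  \<comment> \<open>Since G = K W with W adjoint to K, the form of \<open>G\<close> at
    \<open>x\<close> is the square of \<open>norm (W x)\<close>, and boundedness of K gives the
    estimate with constant \<open>c\<^sup>2\<close>.\<close>
  have "(norm (G x))\<^sup>2 \<le> c\<^sup>2 * Re (cinner (G x) x)" for x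
  proof -
    have "(norm (G x))\<^sup>2 \<le> (norm (W x) * c)\<^sup>2"
      unfolding G_def by (intro power_mono c) simp
    also have "\<dots> = c\<^sup>2 * Re (cinner (W x) (W x))"
      by (simp only: cinner_self Re_complex_of_real power_mult_distrib mult.commute)
    finally show ?thesis
      by (simp add: G_def adjoint_pairD[OF KW])
  qed
  then obtain R where R: "adjoint_pair R R" "\<And>x. 0 \<le> Re (cinner (R x) x)" "\<And>x. R (R x) = G x"
    and R_unique: "\<And>Q. adjoint_pair Q Q \<Longrightarrow> (\<And>x. 0 \<le> Re (cinner (Q x) x)) \<Longrightarrow> (\<And>x. Q (Q x) = G x) \<Longrightarrow> Q = R"
    using positive_sqrt_exists[OF G, of "c\<^sup>2"] \<open>c > 0\<close> by (metis zero_less_power)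
  have adjT: "adj T = moore_penrose (graph_of W)"
    unfolding T_eq by (rule adj_moore_penrose_graph[OF KW])
  have TT: "adj T \<cdot>\<^sub>o T = moore_penrose (graph_of G)"
    unfolding adjT unfolding T_eq G_def
    by (rule moore_penrose_graph_mult[OF WK KW adjoint_pair_kernel[OF KW]])
  have absT: "op_abs T = moore_penrose (graph_of R)"
    unfolding op_abs_def TT
  proof (rule the_equality)
    show "positive_selfadjoint (moore_penrose (graph_of R)) \<and>
        moore_penrose (graph_of R) \<cdot>\<^sub>o moore_penrose (graph_of R) = moore_penrose (graph_of G)"
      using positive_selfadjoint_moore_penrose_graph[OF R(1,2)]
        moore_penrose_graph_mult[OF R(1,1) adjoint_pair_kernel[OF R(1)]] by (simp add: R(3))
  next
    fix P assume "positive_selfadjoint P \<and> P \<cdot>\<^sub>o P = moore_penrose (graph_of G)"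
    then show "P = moore_penrose (graph_of R)"
      by (metis moore_penrose_positive_selfadjoint_sqrt[OF _ G] R_unique)
  qed
  \<comment> \<open>The inverse of T* T is G = K W, so the dual sends x to the inverse of K applied
    to K (W x). This returns \<open>W x\<close>, because \<open>W x\<close> is orthogonal to the
    kernel of \<open>K\<close>.\<close>
  have dual: "cauchy_dual T = graph_of W"
  proof -
    have "(x, z) \<in> cauchy_dual T \<longleftrightarrow> z = W x" for x z
    proof -
      have "(x, z) \<in> cauchy_dual T \<longleftrightarrow> (K (W x), z) \<in> moore_penrose (graph_of K)"
        unfolding cauchy_dual_def TT moore_penrose_moore_penrose_graph[OF G] mem_op_mult
        by (simp add: G_def T_eq[symmetric])
      also have "\<dots> \<longleftrightarrow> z = W x"
      proof
        assume "(K (W x), z) \<in> moore_penrose (graph_of K)"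
        then obtain n where n: "K (W x) = K z + n" "z \<in> orth {x. K x = 0}" "n \<in> orth (range K)"
          unfolding mem_moore_penrose_graph by blast
        have "n = K (W x - z)"
          using n(1) by (simp add: adjoint_pair_diff[OF KW])
        then have "K (W x - z) = 0"
          using orth_disjoint[OF _ n(3)] by auto
        moreover have "W x - z \<in> orth {x. K x = 0}"
          by (intro csubspace_diff csubspace_orth range_subset_orth_kernel[OF KW] n)
        ultimately have "W x - z = 0"
          using orth_disjoint[of "W x - z" "{x. K x = 0}"] by simp
        then show "z = W x" by simp
      next
        assume "z = W x"
        then show "(K (W x), z) \<in> moore_penrose (graph_of K)"
          unfolding mem_moore_penrose_graph
          by (intro exI[of _ 0]) (simp add: range_subset_orth_kernel[OF KW])
      qed
      finally show ?thesis .
    qed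
    then show ?thesis by auto
  qed
  have adj_dual: "adj (cauchy_dual T) = graph_of K"
    unfolding dual by (rule adj_graph_of[OF WK])
  have abs_dual: "op_abs (cauchy_dual T) = graph_of R"
  proof -
    have GG: "adj (cauchy_dual T) \<cdot>\<^sub>o cauchy_dual T = graph_of G"
      unfolding adj_dual unfolding dual graph_of_mult G_def ..
    show ?thesis
      unfolding op_abs_def GG
    proof (rule the_equality)
      show "positive_selfadjoint (graph_of R) \<and> graph_of R \<cdot>\<^sub>o graph_of R = graph_of G"
        using positive_selfadjoint_graph_of[OF R(1,2)] by (simp add: graph_of_mult R(3))
    next
      fix P assume "positive_selfadjoint P \<and> P \<cdot>\<^sub>o P = graph_of G"
      then show "P = graph_of R"
        by (metis bounded_positive_selfadjoint_sqrt R_unique)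
    qed
  qed
  \<comment> \<open>Both \<open>norm (W x)\<close> and \<open>norm (R x)\<close> have square
    \<open>cinner (G x) x\<close>. The common kernel supplies the kernel condition for both products
    below.\<close>
  have kerW: "{x. W x = 0} = {x. R x = 0}"
  proof (intro set_eqI iffI)
    fix x assume "x \<in> {x. W x = 0}"
    then have "R (R x) = 0"
      by (simp add: R(3) G_def adjoint_pair_zero[OF KW])
    then have "cinner (R x) (R x) = 0"
      by (simp add: adjoint_pairD[OF R(1)])
    then show "x \<in> {x. R x = 0}" by simp
  next
    fix x assume "x \<in> {x. R x = 0}"
    then have "K (W x) = 0"
      using R(3)[of x] by (simp add: G_def adjoint_pair_zero[OF R(1)])
    then have "cinner (W x) (W x) = 0"
      using adjoint_pairD[OF KW, of "W x" x] by simp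
    then show "x \<in> {x. W x = 0}" by simp
  qed
  have "op_abs T \<cdot>\<^sub>o adj T = moore_penrose (graph_of (\<lambda>x. W (R x)))"
    unfolding absT adjT
    by (rule moore_penrose_graph_mult[OF R(1) WK]) (simp add: kerW adjoint_pair_kernel[OF R(1)])
  moreover have "T \<cdot>\<^sub>o op_abs T = moore_penrose (graph_of (\<lambda>x. R (K x)))"
    unfolding absT unfolding T_eq
    by (rule moore_penrose_graph_mult[OF KW R(1)]) (simp add: kerW[symmetric] adjoint_pair_kernel[OF WK])
  ultimately have "op_abs T \<cdot>\<^sub>o adj T = T \<cdot>\<^sub>o op_abs T \<longleftrightarrow> (\<lambda>x. W (R x)) = (\<lambda>x. R (K x))"
    by (simp add: moore_penrose_graph_inject[OF adjoint_pair_comp[OF WK R(1)] adjoint_pair_comp[OF R(1) KW]])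
  also have "\<dots> \<longleftrightarrow> op_abs (cauchy_dual T) \<cdot>\<^sub>o adj (cauchy_dual T) = cauchy_dual T \<cdot>\<^sub>o op_abs (cauchy_dual T)"
    unfolding abs_dual adj_dual unfolding dual graph_of_mult graph_of_inject by metis
  finally show ?thesis .
qed

end
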